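(* Let $0<p,q<\infty$ with $p\neq q$. Let $r\in[0,1]$ and let $(t_n)_{n\in\mathbb{N}}\subseteq[0,\infty)$ be a sequence such that $$\lim_{n\to\infty}\sqrt{n}\,(t_nA_{p,q}-1)=\Phi_{p,q}^{-1}(r)$$ (the limit being taken in $[-\infty,+\infty]$), where $\Phi_{p,q}\colon[-\infty,+\infty]\to[0,1]$ is the distribution function of the centred Gaussian distribution with variance $\sigma_{p,q}^2$, i.e. $$\Phi_{p,q}(x)=\frac{1}{\sqrt{2\pi\sigma_{p,q}^2}}\int_{-\infty}^x e^{-s^2/(2\sigma_{p,q}^2)}\,ds .$$ Then $$\lim_{n\to\infty}\bigl|\mathbb{D}_p^n\cap t_n\mathbb{D}_q^n\bigr|=r .$$ In particular, when $t_n=t$ for all $n$, with $t\in[0,\infty)$ constant, $$\lim_{n\to\infty}\bigl|\mathbb{D}_p^n\cap t\,\mathbb{D}_q^n\bigr|=\begin{cases}0 & \text{if } t<1/A_{p,q},\\ 1/2 & \text{if } t=1/A_{p,q},\\ 1 & \text{if } t>1/A_{p,q}.\end{cases}$$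
   Context: $|\cdot|$ denotes $n$-dimensional Lebesgue measure. For $0<p<\infty$ and $x\in\mathbb{R}^n$ let $\|x\|_p:=(\sum_{i=1}^n|x_i|^p)^{1/p}$, $\mathbb{B}_p^n:=\{x\in\mathbb{R}^n:\|x\|_p\le1\}$, and let $\mathbb{D}_p^n:=|\mathbb{B}_p^n|^{-1/n}\,\mathbb{B}_p^n$ be the volume-normalized ball. Let $Z_0$ be a real random variable with density $f_p(x)=\frac{1}{2p^{1/p}\Gamma(1+1/p)}e^{-|x|^p/p}$, $x\in\mathbb{R}$. For $s,s'\ge 0$ put $M_p(s):=\mathbf{E}|Z_0|^s=\frac{p^{s/p}}{s+1}\frac{\Gamma(1+\frac{s+1}{p})}{\Gamma(1+\frac1p)}$ and $C_p(s,s'):=\mathrm{Cov}(|Z_0|^s,|Z_0|^{s'})=M_p(s+s')-M_p(s)M_p(s')$; for $q>0$ put $m_{p,q}:=M_p(q)^{1/q}$. Define $$\sigma_{p,q}^2:=\frac{C_p(q,q)}{q^2M_p(q)^2}-\frac{2\,C_p(p,q)}{pq\,M_p(q)}+\frac{C_p(p,p)}{p^2},$$ which is strictly positive for $p\ne q$. Let $k_{p,n}:=n^{1/p}|\mathbb{B}_p^n|^{1/n}$, $k_{q,n}:=n^{1/q}|\mathbb{B}_q^n|^{1/n}$, and $A_{p,q,n}:=\dfrac{k_{p,n}}{m_{p,q}\,k_{q,n}}$. Then $A_{p,q}:=\lim_{n\to\infty}A_{p,q,n}\in(0,\infty)$ (the limit exists). The conventions $\Phi_{p,q}(-\infty)=0$,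 $\Phi_{p,q}(+\infty)=1$ are used, so $\Phi_{p,q}^{-1}(0)=-\infty$ and $\Phi_{p,q}^{-1}(1)=+\infty$. *)

theory Defs
  imports "HOL-Probability.Probability"
begin

text \<open>
  The dimension n tends to infinity, so \<open>\<real>\<^sup>n\<close> is rendered as the carrier of the n-fold
  product of \<^term>\<open>lborel\<close>: real functions on \<open>{..<n}\<close> that are \<open>undefined\<close>
  elsewhere. All sets measured below are Borel, so completing the measure is unnecessary.
\<close>

definition lebesgue_n :: "nat \<Rightarrow> (nat \<Rightarrow> real) measure" where
  "lebesgue_n n = (\<Pi>\<^sub>M i\<in>{..<n}. lborel)"

definition vol :: "nat \<Rightarrow> (nat \<Rightarrow> real) set \<Rightarrow> real" where
  "vol n A = measure (lebesgue_n n) A"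

definition dilate :: "nat \<Rightarrow> real \<Rightarrow> (nat \<Rightarrow> real) set \<Rightarrow> (nat \<Rightarrow> real) set" where
  "dilate n c A = (\<lambda>x. \<lambda>i\<in>{..<n}. c * x i) ` A"

definition lp_norm :: "real \<Rightarrow> nat \<Rightarrow> (nat \<Rightarrow> real) \<Rightarrow> real" where
  "lp_norm p n x = (\<Sum>i<n. \<bar>x i\<bar> powr p) powr (1 / p)"

definition lp_ball :: "real \<Rightarrow> nat \<Rightarrow> (nat \<Rightarrow> real) set" where
  "lp_ball p n = {x \<in> space (lebesgue_n n). lp_norm p n x \<le> 1}"

definition normalized_lp_ball :: "real \<Rightarrow> nat \<Rightarrow> (nat \<Rightarrow> real) set" where
  "normalized_lp_ball p n = dilate n (vol n (lp_ball p n) powr (- 1 / real n)) (lp_ball p n)"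

definition gen_gaussian_density :: "real \<Rightarrow> real \<Rightarrow> real" where
  "gen_gaussian_density p x =
     1 / (2 * p powr (1 / p) * Gamma (1 + 1 / p)) * exp (- (\<bar>x\<bar> powr p) / p)"

text \<open>The law of the random variable \<open>Z\<^sub>0\<close>; everything below depends only on this law.\<close>

definition gen_gaussian :: "real \<Rightarrow> real measure" where
  "gen_gaussian p = density lborel (\<lambda>x. ennreal (gen_gaussian_density p x))"

text \<open>
  In Isabelle \<open>0 powr 0 = 0\<close>; this affects \<open>s = 0\<close> only on a null set.
\<close>

definition abs_moment :: "real \<Rightarrow> real \<Rightarrow> real" where
  "abs_moment p s = (\<integral>x. \<bar>x\<bar> powr s \<partial>gen_gaussian p)"

definition abs_cov :: "real \<Rightarrow> real \<Rightarrow> real \<Rightarrow> real" where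
  "abs_cov p s s' =
     (\<integral>x. (\<bar>x\<bar> powr s - abs_moment p s) * (\<bar>x\<bar> powr s' - abs_moment p s') \<partial>gen_gaussian p)"

definition m_const :: "real \<Rightarrow> real \<Rightarrow> real" where
  "m_const p q = abs_moment p q powr (1 / q)"

definition sigma_sq :: "real \<Rightarrow> real \<Rightarrow> real" where
  "sigma_sq p q =
     abs_cov p q q / (q\<^sup>2 * (abs_moment p q)\<^sup>2)
     - 2 * abs_cov p p q / (p * q * abs_moment p q)
     + abs_cov p p p / p\<^sup>2"

definition k_const :: "real \<Rightarrow> nat \<Rightarrow> real" where
  "k_const p n = real n powr (1 / p) * vol n (lp_ball p n) powr (1 / real n)"

definition A_seq :: "real \<Rightarrow> real \<Rightarrow> nat \<Rightarrow> real" where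
  "A_seq p q n = k_const p n / (m_const p q * k_const q n)"

definition A_lim :: "real \<Rightarrow> real \<Rightarrow> real" where
  "A_lim p q = lim (A_seq p q)"

text \<open>
  \<^const>\<open>normal_density\<close> takes the standard deviation, hence the square root.
\<close>

definition Phi :: "real \<Rightarrow> real \<Rightarrow> ereal \<Rightarrow> real" where
  "Phi p q x = (case x of
       ereal y \<Rightarrow> cdf (density lborel (\<lambda>s. ennreal (normal_density 0 (sqrt (sigma_sq p q)) s))) y
     | PInfty \<Rightarrow> 1
     | MInfty \<Rightarrow> 0)"

end

theory Submission
  imports Defs "HOL-Real_Asymp.Real_Asymp"
begin

text \<open>
  For \<open>n \<ge> 1\<close>, undoing the normalization turns the volume in question into the share of
  the ball \<open>lp_ball p n\<close> on which the q-norm is at most \<open>t n * A_seq p q n\<close> times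
  \<open>m_const p q * n powr (1/q - 1/p)\<close> (lemma \<open>vol_normalized_intersection\<close>). That factor is
  the size of the q-norm of a typical point, so everything happens in a window of relative
  width \<open>1 / sqrt n\<close>: the thresholds to be understood are \<open>exp (y / sqrt n)\<close> times the
  typical size.

  The share is compared with a probability about independent variables \<open>Z i\<close> of law
  \<open>gen_gaussian p\<close>. Their joint density depends on the p-norm only and is an average of
  indicators of p-balls, because \<open>exp (- c)\<close> is the integral of \<open>exp (- u)\<close> over \<open>u \<ge> c\<close>.
  Since Lebesgue measure is homogeneous, the product measure therefore gives every cone
  exactly the share of the unit p-ball that the cone fills (lemma
  \<open>measure_PiM_gen_gaussian_cone\<close>). Taking the whole space as the cone evaluates the
  volume of the ball. Applied to the cone on which the q-norm is at most \<open>c\<close> times the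
  p-norm, it bounds the wanted share from below, as the p-norm is at most 1 on the ball.
  Conversely, all but the fraction \<open>\<rho> ^ n\<close> of the ball has p-norm above \<open>\<rho>\<close>, and
  \<open>\<rho> = exp (- \<epsilon> / sqrt n)\<close> makes this fraction vanish while shifting \<open>y\<close> only to \<open>y + \<epsilon>\<close>.

  It remains to find the limit law of the ratio of the q-norm and the p-norm of \<open>Z\<close>. Both
  norms are powers of sums of independent terms; with \<open>\<xi>\<close> and \<open>\<eta>\<close> the relative deviations
  of these sums from their means, the logarithm of the normalized ratio is
  \<open>ln (1 + \<xi>) / q - ln (1 + \<eta>) / p\<close>. Its linear part \<open>\<xi> / q - \<eta> / p\<close> is the mean of
  independent copies of the variable \<open>log_ratio_score p q\<close>, whose variance is
  \<open>sigma_sq p q\<close>, and obeys the central limit theorem. The quadratic error disappears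
  because \<open>sqrt n * \<xi>\<^sup>2\<close> has expectation of order \<open>1 / sqrt n\<close> (lemma
  \<open>cone_prob_tendsto\<close>). The variance is positive because the score is a continuous
  function that vanishes identically only for \<open>p = q\<close>.

  Finally \<open>A_seq p q n\<close> has to be replaced by its limit. A crude form of Stirling's
  formula, with error \<open>O(ln x)\<close> in \<open>ln (Gamma (1 + x))\<close>, gives
  \<open>ln (A_seq p q n) - ln (A_lim p q) = O(ln n / n)\<close>, which is negligible against
  \<open>1 / sqrt n\<close> (lemma \<open>ln_A_seq_asymp\<close>). As the share is monotone in the threshold, the
  limits at the fixed real points \<open>y\<close> determine the limit along any sequence of
  thresholds, including those with \<open>y = \<plusminus>\<infinity>\<close> in the limit. A constant \<open>t\<close> is one of the
  three cases \<open>y = -\<infinity>\<close>, \<open>y = 0\<close>, \<open>y = \<infinity>\<close>.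
\<close>

section \<open>Gamma integrals by slicing the exponential\<close>

lemma powr_le_cancel_base:
  fixes a x y :: real
  assumes "0 < a" "0 \<le> x" "0 \<le> y"
  shows "x powr a \<le> y powr a \<longleftrightarrow> x \<le> y"
  using assms powr_less_mono2[of a y x] powr_mono2[of a x y] by linarith

lemma Gamma_1_plus_pos: "0 \<le> x \<Longrightarrow> 0 < Gamma (1 + x :: real)"
  by (rule Gamma_real_pos) simp

lemma nn_integral_exp_tail:
  assumes "0 \<le> c"
  shows "(\<integral>\<^sup>+u. ennreal (exp (- u)) * indicator {c..} u \<partial>lborel) = ennreal (exp (- c))"
proof -
  have "(\<integral>\<^sup>+u. ennreal (exp (- u)) * indicator {c..} u \<partial>lborel) = ennreal (0 - (- exp (- c)))"
  proof (rule nn_integral_FTC_atLeast)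
    show "((\<lambda>u::real. - exp (- u)) \<longlongrightarrow> 0) at_top"
      using tendsto_minus[OF filterlim_compose[OF exp_at_bot filterlim_uminus_at_bot_at_top]]
      by simp
  qed (auto intro!: derivative_eq_intros)
  then show ?thesis by simp
qed

text \<open>
  Writing \<open>exp (- \<phi> x)\<close> as the integral of \<open>exp (- u)\<close> over \<open>u \<ge> \<phi> x\<close> and exchanging the
  integrals reduces everything to the sublevel sets of \<open>\<phi>\<close>; if their weight is a power of
  \<open>u\<close>, a Gamma integral is left. This one computation yields the one-dimensional moments
  as well as the comparison of the product law with the volume of the p-ball.
\<close>
lemma (in sigma_finite_measure) nn_integral_exp_homogeneous:
  fixes \<phi> :: "'a \<Rightarrow> real" and g :: "'a \<Rightarrow> ennreal"
  assumes [measurable]: "\<phi> \<in> borel_measurable M" "g \<in> borel_measurable M"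
    and nonneg: "\<And>x. x \<in> space M \<Longrightarrow> 0 \<le> \<phi> x" and a: "0 \<le> a"
    and level: "\<And>u. 0 < u \<Longrightarrow> (\<integral>\<^sup>+x. g x * indicator {x. \<phi> x \<le> u} x \<partial>M) = K * ennreal (u powr a)"
  shows "(\<integral>\<^sup>+x. g x * ennreal (exp (- \<phi> x)) \<partial>M) = K * ennreal (Gamma (1 + a))"
proof -
  interpret L: pair_sigma_finite lborel M
    by (simp add: pair_sigma_finite_def sigma_finite_lborel sigma_finite_measure_axioms)
  have "(\<integral>\<^sup>+x. g x * ennreal (exp (- \<phi> x)) \<partial>M)
      = (\<integral>\<^sup>+x. (\<integral>\<^sup>+u. g x * (ennreal (exp (- u)) * indicator {\<phi> x..} u) \<partial>lborel) \<partial>M)"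
    by (intro nn_integral_cong) (simp add: nn_integral_cmult nn_integral_exp_tail nonneg)
  also have "\<dots> = (\<integral>\<^sup>+x. (\<integral>\<^sup>+u. g x * (ennreal (exp (- u)) * indicator {x. \<phi> x \<le> u} x) \<partial>lborel) \<partial>M)"
    by (intro nn_integral_cong) (simp split: split_indicator)
  also have "\<dots> = (\<integral>\<^sup>+u. (\<integral>\<^sup>+x. g x * (ennreal (exp (- u)) * indicator {x. \<phi> x \<le> u} x) \<partial>M) \<partial>lborel)"
    by (rule L.Fubini') (simp add: indicator_def split_beta')
  also have "\<dots> = (\<integral>\<^sup>+u. ennreal (exp (- u)) * (\<integral>\<^sup>+x. g x * indicator {x. \<phi> x \<le> u} x \<partial>M) \<partial>lborel)"
    by (intro nn_integral_cong)
       (subst nn_integral_cmult[symmetric], auto simp: indicator_def mult_ac)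
  also have "\<dots> = (\<integral>\<^sup>+u. K * ennreal (indicator {0..} u * u powr a / exp u) \<partial>lborel)"
  proof (rule nn_integral_cong_AE)
    have "AE u in lborel. u \<noteq> (0::real)"
      by (rule AE_lborel_singleton)
    then show "AE u in lborel. ennreal (exp (- u)) * (\<integral>\<^sup>+x. g x * indicator {x. \<phi> x \<le> u} x \<partial>M)
        = K * ennreal (indicator {0..} u * u powr a / exp u)"
    proof eventually_elim
      fix u :: real assume "u \<noteq> 0"
      \<comment> \<open>The point \<open>u = 0\<close> is excluded because \<open>0 powr a\<close> vanishes even for \<open>a = 0\<close>.\<close>
      show "ennreal (exp (- u)) * (\<integral>\<^sup>+x. g x * indicator {x. \<phi> x \<le> u} x \<partial>M)
        = K * ennreal (indicator {0..} u * u powr a / exp u)"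
      proof (cases "u > 0")
        case True
        then show ?thesis
          by (simp add: level exp_minus field_simps flip: ennreal_mult)
      next
        case False
        with \<open>u \<noteq> 0\<close> have "u < 0" by simp
        then have "(\<integral>\<^sup>+x. g x * indicator {x. \<phi> x \<le> u} x \<partial>M) = (\<integral>\<^sup>+x. 0 \<partial>M)"
          by (intro nn_integral_cong) (use nonneg in \<open>force split: split_indicator\<close>)
        with \<open>u < 0\<close> show ?thesis by simp
      qed
    qed
  qed
  also have "\<dots> = K * ennreal (Gamma (1 + a))"
    using Gamma_conv_nn_integral_real[of "1 + a"] a
    by (simp add: nn_integral_cmult add_pos_nonneg)
  finally show ?thesis .
qed

lemma nn_integral_abs_powr_Icc:
  assumes s: "0 \<le> s" and R: "0 \<le> R"
  shows "(\<integral>\<^sup>+x. ennreal (\<bar>x\<bar> powr s) * indicator {-R..R} x \<partial>lborel) = ennreal (2 * R powr (s + 1) / (s + 1))"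
proof -
  have pos: "((\<lambda>x. \<bar>x\<bar> powr s) has_integral (R powr (s+1) / (s+1))) {0..R}"
    using has_integral_powr_from_0[of s R] assms
    by (subst has_integral_cong[of _ _ "\<lambda>x. x powr s"]) auto
  have neg: "((\<lambda>x. \<bar>x\<bar> powr s) has_integral (R powr (s+1) / (s+1))) {-R..0}"
    using iffD2[OF has_integral_reflect_real, OF pos] by simp
  have "((\<lambda>x. \<bar>x\<bar> powr s) has_integral (R powr (s+1) / (s+1) + R powr (s+1) / (s+1))) {-R..R}"
    by (rule has_integral_combine[OF _ _ neg pos]) (use R in auto)
  from nn_integral_has_integral_lebesgue'[OF _ this]
  show ?thesis by simp
qed

lemma nn_integral_abs_powr_exp:
  assumes p: "0 < p" and s: "0 \<le> s"
  shows "(\<integral>\<^sup>+x. ennreal (\<bar>x\<bar> powr s) * ennreal (exp (- (\<bar>x\<bar> powr p / p))) \<partial>lborel)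
    = ennreal (2 * p powr ((s + 1) / p) / (s + 1) * Gamma (1 + (s + 1) / p))"
proof -
  have "(\<integral>\<^sup>+x. ennreal (\<bar>x\<bar> powr s) * ennreal (exp (- (\<bar>x\<bar> powr p / p))) \<partial>lborel)
    = ennreal (2 * p powr ((s + 1) / p) / (s + 1)) * ennreal (Gamma (1 + (s + 1) / p))"
  proof (rule lborel.nn_integral_exp_homogeneous)
    fix u :: real assume u: "0 < u"
    have iff: "\<bar>x\<bar> powr p / p \<le> u \<longleftrightarrow> \<bar>x\<bar> \<le> (p * u) powr (1 / p)" for x :: real
    proof -
      have "\<bar>x\<bar> powr p / p \<le> u \<longleftrightarrow> \<bar>x\<bar> powr p \<le> ((p * u) powr (1 / p)) powr p"
        using p u by (simp add: powr_powr field_simps)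
      also have "\<dots> \<longleftrightarrow> \<bar>x\<bar> \<le> (p * u) powr (1 / p)"
        using p by (intro powr_le_cancel_base) auto
      finally show ?thesis .
    qed
    have "(\<integral>\<^sup>+x. ennreal (\<bar>x\<bar> powr s) * indicator {x. \<bar>x\<bar> powr p / p \<le> u} x \<partial>lborel)
      = (\<integral>\<^sup>+x. ennreal (\<bar>x\<bar> powr s) * indicator {- ((p * u) powr (1 / p))..(p * u) powr (1 / p)} x \<partial>lborel)"
      by (intro nn_integral_cong) (auto simp: iff abs_le_iff split: split_indicator)
    also have "\<dots> = ennreal (2 * ((p * u) powr (1 / p)) powr (s + 1) / (s + 1))"
      by (rule nn_integral_abs_powr_Icc) (use s in auto)
    also have "\<dots> = ennreal (2 * p powr ((s + 1) / p) / (s + 1)) * ennreal (u powr ((s + 1) / p))"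
      using p s u by (simp add: powr_powr powr_mult flip: ennreal_mult)
    finally show "(\<integral>\<^sup>+x. ennreal (\<bar>x\<bar> powr s) * indicator {x. \<bar>x\<bar> powr p / p \<le> u} x \<partial>lborel)
      = ennreal (2 * p powr ((s + 1) / p) / (s + 1)) * ennreal (u powr ((s + 1) / p))" .
  qed (use p s in auto)
  also have "\<dots> = ennreal (2 * p powr ((s + 1) / p) / (s + 1) * Gamma (1 + (s + 1) / p))"
    using p s Gamma_1_plus_pos[of "(s + 1) / p"] by (intro ennreal_mult[symmetric]) auto
  finally show ?thesis .
qed

section \<open>The generalized Gaussian law and its moments\<close>

lemma gen_gaussian_density_borel [measurable]: "gen_gaussian_density p \<in> borel_measurable borel"
  unfolding gen_gaussian_density_def[abs_def] by measurable

lemma gen_gaussian_density_pos: "0 < p \<Longrightarrow> 0 < gen_gaussian_density p x"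
  by (simp add: gen_gaussian_density_def Gamma_1_plus_pos)

lemma sets_gen_gaussian [simp, measurable_cong]: "sets (gen_gaussian p) = sets borel"
  by (simp add: gen_gaussian_def)

lemma space_gen_gaussian [simp]: "space (gen_gaussian p) = UNIV"
  by (simp add: gen_gaussian_def)

lemma nn_integral_gen_gaussian_powr:
  assumes p: "0 < p" and s: "0 \<le> s"
  shows "(\<integral>\<^sup>+x. ennreal (\<bar>x\<bar> powr s) \<partial>gen_gaussian p)
    = ennreal (p powr (s / p) / (s + 1) * Gamma (1 + (s + 1) / p) / Gamma (1 + 1 / p))"
proof -
  let ?c = "1 / (2 * p powr (1 / p) * Gamma (1 + 1 / p))"
  have G: "0 < Gamma (1 + 1 / p)" "0 < Gamma (1 + (s + 1) / p)"
    using p s by (simp_all add: Gamma_1_plus_pos)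
  have "(\<integral>\<^sup>+x. ennreal (\<bar>x\<bar> powr s) \<partial>gen_gaussian p)
    = (\<integral>\<^sup>+x. ennreal ?c * (ennreal (\<bar>x\<bar> powr s) * ennreal (exp (- (\<bar>x\<bar> powr p / p)))) \<partial>lborel)"
    unfolding gen_gaussian_def using G
    by (subst nn_integral_density)
       (auto intro!: nn_integral_cong simp: gen_gaussian_density_def mult_ac simp flip: ennreal_mult)
  also have "\<dots> = ennreal ?c * ennreal (2 * p powr ((s + 1) / p) / (s + 1) * Gamma (1 + (s + 1) / p))"
    by (subst nn_integral_cmult) (simp_all add: nn_integral_abs_powr_exp[OF p s])
  also have "\<dots> = ennreal (?c * (2 * p powr ((s + 1) / p) / (s + 1) * Gamma (1 + (s + 1) / p)))"
    using p s G by (intro ennreal_mult[symmetric]) auto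
  also have "?c * (2 * p powr ((s + 1) / p) / (s + 1) * Gamma (1 + (s + 1) / p))
    = p powr (s / p) / (s + 1) * Gamma (1 + (s + 1) / p) / Gamma (1 + 1 / p)"
  proof -
    have "p powr ((s + 1) / p) = p powr (s / p) * p powr (1 / p)"
      by (simp add: add_divide_distrib powr_add)
    then show ?thesis using p s G by simp
  qed
  finally show ?thesis .
qed

lemma prob_space_gen_gaussian:
  assumes p: "0 < p"
  shows "prob_space (gen_gaussian p)"
proof
  have "AE x in gen_gaussian p. x \<noteq> 0"
    unfolding gen_gaussian_def
    by (subst AE_density) (use AE_lborel_singleton[of "0::real"] in auto)
  then have "(\<integral>\<^sup>+x. 1 \<partial>gen_gaussian p) = (\<integral>\<^sup>+x. ennreal (\<bar>x\<bar> powr 0) \<partial>gen_gaussian p)"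
    by (intro nn_integral_cong_AE) auto
  also have "\<dots> = 1"
    using nn_integral_gen_gaussian_powr[OF p, of 0] p Gamma_1_plus_pos[of "1 / p"]
    by simp
  finally show "emeasure (gen_gaussian p) (space (gen_gaussian p)) = 1"
    by simp
qed

lemma
  assumes p: "0 < p" and s: "0 \<le> s"
  shows integrable_gen_gaussian_powr: "integrable (gen_gaussian p) (\<lambda>x. \<bar>x\<bar> powr s)"
    and abs_moment_eq: "abs_moment p s
      = p powr (s / p) / (s + 1) * Gamma (1 + (s + 1) / p) / Gamma (1 + 1 / p)"
proof -
  have G: "0 < Gamma (1 + 1 / p)" "0 < Gamma (1 + (s + 1) / p)"
    using p s by (simp_all add: Gamma_1_plus_pos)
  have "has_bochner_integral (gen_gaussian p) (\<lambda>x. \<bar>x\<bar> powr s)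
      (p powr (s / p) / (s + 1) * Gamma (1 + (s + 1) / p) / Gamma (1 + 1 / p))"
    using nn_integral_gen_gaussian_powr[OF p s] G p s
    by (intro has_bochner_integral_nn_integral) auto
  then show "integrable (gen_gaussian p) (\<lambda>x. \<bar>x\<bar> powr s)"
    and "abs_moment p s = p powr (s / p) / (s + 1) * Gamma (1 + (s + 1) / p) / Gamma (1 + 1 / p)"
    by (auto simp: abs_moment_def has_bochner_integral_iff)
qed

lemma abs_moment_pos: "0 < p \<Longrightarrow> 0 \<le> s \<Longrightarrow> 0 < abs_moment p s"
  by (simp add: abs_moment_eq Gamma_1_plus_pos)

text \<open>
  The division by \<open>p\<close> in the exponent of the density makes this moment 1. This is the
  reason why only the q-norm needs a normalizing constant in \<^const>\<open>A_seq\<close>.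
\<close>
lemma abs_moment_self:
  assumes p: "0 < p"
  shows "abs_moment p p = 1"
proof -
  have "Gamma (1 + (p + 1) / p) = (1 + 1 / p) * Gamma (1 + 1 / p)"
  proof -
    have "1 + 1 / p > 0" using p by (simp add: add_pos_pos)
    then have "1 + 1 / p \<notin> \<int>\<^sub>\<le>\<^sub>0" using nonpos_Ints_nonpos[of "1 + 1 / p"] by linarith
    from Gamma_plus1[OF this] show ?thesis using p by (simp add: add_divide_distrib add_ac)
  qed
  moreover have "Gamma (1 + 1 / p) > 0"
    using p by (simp add: Gamma_1_plus_pos)
  ultimately have "abs_moment p p = p / (p + 1) * (1 + 1 / p)"
    using p by (simp add: abs_moment_eq)
  also have "1 + 1 / p = (p + 1) / p" using p by (simp add: add_divide_distrib)
  also have "p / (p + 1) * ((p + 1) / p) = 1" using p by simp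
  finally show ?thesis .
qed

section \<open>The linearized logarithm of the norm ratio\<close>

text \<open>
  The derivative at 0 of \<open>ln (1 + \<xi>) / q - ln (1 + \<eta>) / p\<close> in the direction given by the
  relative deviations \<open>\<xi>\<close> and \<open>\<eta>\<close> of \<open>\<bar>x\<bar> powr q\<close> and \<open>\<bar>x\<bar> powr p\<close> from their means: what
  a single coordinate contributes to the logarithm of the norm ratio.
\<close>
definition log_ratio_score :: "real \<Rightarrow> real \<Rightarrow> real \<Rightarrow> real" where
  "log_ratio_score p q x =
     (\<bar>x\<bar> powr q - abs_moment p q) / (q * abs_moment p q) - (\<bar>x\<bar> powr p - abs_moment p p) / p"

lemma log_ratio_score_borel [measurable]: "log_ratio_score p q \<in> borel_measurable borel"
  unfolding log_ratio_score_def[abs_def] by measurable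

lemma integrable_centred_product:
  assumes p: "0 < p" and s: "0 \<le> s" "0 \<le> s'"
  shows "integrable (gen_gaussian p)
    (\<lambda>x. (\<bar>x\<bar> powr s - abs_moment p s) * (\<bar>x\<bar> powr s' - abs_moment p s'))"
proof -
  interpret prob_space "gen_gaussian p" by (rule prob_space_gen_gaussian[OF p])
  have "integrable (gen_gaussian p) (\<lambda>x::real. \<bar>x\<bar> powr (s + s') - abs_moment p s' * \<bar>x\<bar> powr s
      - abs_moment p s * \<bar>x\<bar> powr s' + abs_moment p s * abs_moment p s')"
    using assms by (intro Bochner_Integration.integrable_add Bochner_Integration.integrable_diff
        integrable_mult_right integrable_gen_gaussian_powr) auto
  then show ?thesis by (simp add: powr_add algebra_simps)
qed

lemma
  assumes p: "0 < p" and q: "0 < q"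
  shows integral_log_ratio_score: "integral\<^sup>L (gen_gaussian p) (log_ratio_score p q) = 0"
    and integrable_log_ratio_score_sq: "integrable (gen_gaussian p) (\<lambda>x. (log_ratio_score p q x)\<^sup>2)"
    and integral_log_ratio_score_sq: "(\<integral>x. (log_ratio_score p q x)\<^sup>2 \<partial>gen_gaussian p) = sigma_sq p q"
proof -
  interpret prob_space "gen_gaussian p" by (rule prob_space_gen_gaussian[OF p])
  let ?M = "abs_moment p q"
  let ?Q = "\<lambda>x::real. \<bar>x\<bar> powr q - ?M" and ?P = "\<lambda>x::real. \<bar>x\<bar> powr p - abs_moment p p"
  have M: "0 < ?M" using p q by (simp add: abs_moment_pos)
  note [simp] = integrable_gen_gaussian_powr[OF p]
  show "integral\<^sup>L (gen_gaussian p) (log_ratio_score p q) = 0"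
    unfolding log_ratio_score_def[abs_def] using p q
    by (simp add: prob_space[simplified] flip: abs_moment_def)
  have eq: "(log_ratio_score p q x)\<^sup>2 = (?Q x * ?Q x) / (q\<^sup>2 * ?M\<^sup>2)
      - 2 * (?P x * ?Q x) / (p * q * ?M) + (?P x * ?P x) / p\<^sup>2" for x
    using p q M by (simp add: log_ratio_score_def field_simps power2_eq_square)
  note [simp] = integrable_centred_product[OF p]
  show "integrable (gen_gaussian p) (\<lambda>x. (log_ratio_score p q x)\<^sup>2)"
    unfolding eq using p q
    by (intro Bochner_Integration.integrable_add Bochner_Integration.integrable_diff integrable_divide integrable_mult_right) auto
  show "(\<integral>x. (log_ratio_score p q x)\<^sup>2 \<partial>gen_gaussian p) = sigma_sq p q"
    unfolding eq using p q
    by (subst Bochner_Integration.integral_add integral_diff; auto simp: sigma_sq_def abs_cov_def)+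
qed

text \<open>
  On the positive half-line the score is \<open>a * x powr q - b * x powr p\<close> up to a constant.
  If it vanished at 1, 2 and 4, the increments of the two powers would be proportional on
  both steps, forcing \<open>2 powr q = 2 powr p\<close>.
\<close>
lemma log_ratio_score_not_identically_0:
  assumes p: "0 < p" and q: "0 < q" and "p \<noteq> q"
  shows "\<exists>x>0. log_ratio_score p q x \<noteq> 0"
proof (rule ccontr)
  assume "\<not> ?thesis"
  then have zero: "log_ratio_score p q x = 0" if "x > 0" for x using that by blast
  define a b where "a = 1 / (q * abs_moment p q)" and "b = 1 / p"
  define u v where "u = (2::real) powr q" and "v = (2::real) powr p"
  have M: "0 < abs_moment p q" using p q by (simp add: abs_moment_pos)
  have W: "log_ratio_score p q x = a * x powr q - b * x powr p - (1 / q - b * abs_moment p p)" if "x > 0" for x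
    using that M p q by (simp add: log_ratio_score_def a_def b_def field_simps)
  have four: "4 powr s = (2 powr s) * (2 powr s)" for s :: real
    by (simp flip: powr_mult)
  from zero[of 1] zero[of 2] zero[of 4]
  have e: "a - b = a * u - b * v" "a * u - b * v = a * (u * u) - b * (v * v)"
    by (simp_all add: W u_def v_def four)
  have "a * (u - 1) = b * (v - 1)" using e by (simp add: algebra_simps)
  moreover have "u * (a * (u - 1)) = v * (b * (v - 1))" using e by (simp add: algebra_simps)
  ultimately have "(u - v) * (a * (u - 1)) = 0" by algebra
  moreover have "u > 1" using q powr_less_mono[of 0 q 2] by (simp add: u_def)
  moreover have "a > 0" using M q by (simp add: a_def)
  ultimately have "u = v" by simp
  then have "q = p" by (simp add: u_def v_def powr_inj)
  with \<open>p \<noteq> q\<close> show False by simp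
qed

text \<open>
  The density is positive everywhere, so zero variance would make the score vanish almost
  everywhere; being continuous on the positive half-line, it would vanish there
  identically.
\<close>
lemma sigma_sq_pos:
  assumes p: "0 < p" and q: "0 < q" and "p \<noteq> q"
  shows "0 < sigma_sq p q"
proof -
  let ?W = "log_ratio_score p q"
  have "sigma_sq p q \<noteq> 0"
  proof
    assume "sigma_sq p q = 0"
    then have "AE x in gen_gaussian p. (?W x)\<^sup>2 = 0"
      using integral_nonneg_eq_0_iff_AE[OF integrable_log_ratio_score_sq[OF p q]]
        integral_log_ratio_score_sq[OF p q] by simp
    then have "AE x in lborel. ?W x = 0"
      unfolding gen_gaussian_def using gen_gaussian_density_pos[OF p]
      by (subst (asm) AE_density) auto
    moreover have "{x \<in> space lborel. \<not> ?W x = 0} \<in> sets lborel"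
      by measurable
    ultimately have null: "{x. ?W x \<noteq> 0} \<in> null_sets lborel"
      by (subst (asm) AE_iff_null) auto
    have "open {x \<in> {0<..}. ?W x \<noteq> 0}"
    proof -
      have "continuous_on {0<..} ?W"
        unfolding log_ratio_score_def[abs_def] using p q abs_moment_pos[of p q]
        by (intro continuous_intros) auto
      then have "open ({0<..} \<inter> ?W -` (- {0}))"
        by (rule continuous_open_preimage) auto
      also have "{0<..} \<inter> ?W -` (- {0}) = {x \<in> {0<..}. ?W x \<noteq> 0}" by auto
      finally show ?thesis .
    qed
    moreover have "{x \<in> {0<..}. ?W x \<noteq> 0} \<noteq> {}"
      using log_ratio_score_not_identically_0[OF assms] by auto
    ultimately have "\<not> negligible {x \<in> {0<..}. ?W x \<noteq> 0}"
      by (rule open_not_negligible)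
    moreover have "negligible {x. ?W x \<noteq> 0}"
      using null by (simp add: negligible_iff_null_sets null_sets_completionI)
    ultimately show False
      by (metis (no_types, lifting) Collect_mono_iff negligible_subset)
  qed
  moreover have "0 \<le> sigma_sq p q"
    unfolding integral_log_ratio_score_sq[OF p q, symmetric] by simp
  ultimately show ?thesis by simp
qed

section \<open>Scaling of n-dimensional Lebesgue measure\<close>

lemma sets_lebesgue_n [measurable_cong]: "sets (lebesgue_n n) = sets (\<Pi>\<^sub>M i\<in>{..<n}. borel)"
  unfolding lebesgue_n_def by (intro sets_PiM_cong) auto

lemma space_lebesgue_n: "space (lebesgue_n n) = extensional {..<n}"
  by (auto simp: lebesgue_n_def space_PiM PiE_def)

lemma sigma_finite_lebesgue_n: "sigma_finite_measure (lebesgue_n n)"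
proof -
  interpret finite_product_sigma_finite "\<lambda>_. lborel :: real measure" "{..<n}"
    by standard simp
  show ?thesis unfolding lebesgue_n_def by (rule sigma_finite_measure_axioms)
qed

definition scale_vec :: "nat \<Rightarrow> real \<Rightarrow> (nat \<Rightarrow> real) \<Rightarrow> nat \<Rightarrow> real" where
  "scale_vec n c x = (\<lambda>i\<in>{..<n}. c * x i)"

lemma scale_vec_in_space [simp]: "scale_vec n c x \<in> space (lebesgue_n n)"
  by (simp add: scale_vec_def space_lebesgue_n)

lemma scale_vec_scale_vec: "scale_vec n a (scale_vec n b x) = scale_vec n (a * b) x"
  by (auto simp: scale_vec_def restrict_def)

lemma scale_vec_1: "x \<in> space (lebesgue_n n) \<Longrightarrow> scale_vec n 1 x = x"
  by (simp add: scale_vec_def space_lebesgue_n extensional_restrict)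

lemma measurable_scale_vec [measurable]: "scale_vec n c \<in> lebesgue_n n \<rightarrow>\<^sub>M lebesgue_n n"
  unfolding lebesgue_n_def scale_vec_def[abs_def] by measurable

lemma lebesgue_n_scale:
  assumes c: "0 < c"
  shows "density (distr (lebesgue_n n) (lebesgue_n n) (scale_vec n c)) (\<lambda>_. ennreal (c ^ n)) = lebesgue_n n"
proof -
  interpret product_sigma_finite "\<lambda>_. lborel :: real measure"
    by standard
  have "density (distr (lebesgue_n n) (lebesgue_n n) (scale_vec n c)) (\<lambda>_. ennreal (c ^ n)) = (\<Pi>\<^sub>M i\<in>{..<n}. lborel)"
  proof (rule PiM_eqI)
    fix A :: "nat \<Rightarrow> real set" assume A: "\<And>i. i \<in> {..<n} \<Longrightarrow> A i \<in> sets lborel"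
    then have box: "Pi\<^sub>E {..<n} A \<in> sets (lebesgue_n n)"
      unfolding lebesgue_n_def by (intro sets_PiM_I_finite) auto
    have vim: "(\<lambda>x. c * x) -` A i \<in> sets lborel" if "i < n" for i
    proof -
      have [measurable]: "A i \<in> sets borel" using A that by simp
      have "(\<lambda>x. c * x) -` A i \<inter> space borel \<in> sets borel" by measurable
      then show ?thesis by simp
    qed
    have "scale_vec n c -` Pi\<^sub>E {..<n} A \<inter> space (lebesgue_n n) = Pi\<^sub>E {..<n} (\<lambda>i. (\<lambda>x. c * x) -` A i)"
      by (auto simp: scale_vec_def space_lebesgue_n PiE_def Pi_def)
    then have "emeasure (density (distr (lebesgue_n n) (lebesgue_n n) (scale_vec n c)) (\<lambda>_. ennreal (c ^ n))) (Pi\<^sub>E {..<n} A)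
      = ennreal (c ^ n) * emeasure (lebesgue_n n) (Pi\<^sub>E {..<n} (\<lambda>i. (\<lambda>x. c * x) -` A i))"
      using box by (simp add: emeasure_density_const emeasure_distr)
    also have "\<dots> = (\<Prod>i<n. ennreal c) * (\<Prod>i<n. emeasure lborel ((\<lambda>x. c * x) -` A i))"
      unfolding lebesgue_n_def using vim c by (subst emeasure_PiM) (auto simp: ennreal_power)
    also have "\<dots> = (\<Prod>i<n. emeasure lborel (A i))"
      unfolding prod.distrib[symmetric]
    proof (rule prod.cong)
      fix i assume "i \<in> {..<n}"
      then have Ai: "A i \<in> sets borel" using A by auto
      have "emeasure lborel (A i) = emeasure (density (distr lborel borel (\<lambda>x. 0 + c * x)) (\<lambda>_. ennreal \<bar>c\<bar>)) (A i)"
        using lborel_real_affine[of c 0] c by simp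
      also have "\<dots> = ennreal c * emeasure lborel ((\<lambda>x. c * x) -` A i)"
        using Ai c by (simp add: emeasure_density_const emeasure_distr)
      finally show "ennreal c * emeasure lborel ((\<lambda>x. c * x) -` A i) = emeasure lborel (A i)" ..
    qed simp
    finally show "emeasure (density (distr (lebesgue_n n) (lebesgue_n n) (scale_vec n c)) (\<lambda>_. ennreal (c ^ n))) (Pi\<^sub>E {..<n} A)
      = (\<Prod>i<n. emeasure lborel (A i))" .
  qed (auto simp: lebesgue_n_def)
  then show ?thesis by (simp add: lebesgue_n_def)
qed

lemma emeasure_lebesgue_n_scale:
  assumes "0 < c" and [measurable]: "A \<in> sets (lebesgue_n n)"
  shows "emeasure (lebesgue_n n) A = ennreal (c ^ n) * emeasure (lebesgue_n n) {x \<in> space (lebesgue_n n). scale_vec n c x \<in> A}"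
proof -
  have "emeasure (lebesgue_n n) A
    = emeasure (density (distr (lebesgue_n n) (lebesgue_n n) (scale_vec n c)) (\<lambda>_. ennreal (c ^ n))) A"
    using lebesgue_n_scale[OF assms(1)] by simp
  also have "\<dots> = ennreal (c ^ n) * emeasure (lebesgue_n n) (scale_vec n c -` A \<inter> space (lebesgue_n n))"
    by (simp add: emeasure_density_const emeasure_distr)
  also have "scale_vec n c -` A \<inter> space (lebesgue_n n) = {x \<in> space (lebesgue_n n). scale_vec n c x \<in> A}"
    by auto
  finally show ?thesis .
qed

section \<open>Cones under the product law\<close>

lemma PiM_gen_gaussian_eq_density:
  assumes p: "0 < p"
  shows "(\<Pi>\<^sub>M i\<in>{..<n}. gen_gaussian p)
    = density (lebesgue_n n) (\<lambda>x. \<Prod>i<n. ennreal (gen_gaussian_density p (x i)))"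
proof -
  interpret G: prob_space "gen_gaussian p" by (rule prob_space_gen_gaussian[OF p])
  interpret product_sigma_finite "\<lambda>_. gen_gaussian p"
    by standard
  interpret L: product_sigma_finite "\<lambda>_. lborel :: real measure"
    by standard
  have [measurable]: "(\<lambda>x. \<Prod>i<n. ennreal (gen_gaussian_density p (x i))) \<in> borel_measurable (lebesgue_n n)"
    unfolding lebesgue_n_def by measurable
  show ?thesis
  proof (rule PiM_eqI[symmetric])
    fix A :: "nat \<Rightarrow> real set" assume A: "\<And>i. i \<in> {..<n} \<Longrightarrow> A i \<in> sets (gen_gaussian p)"
    then have box: "Pi\<^sub>E {..<n} A \<in> sets (lebesgue_n n)"
      unfolding lebesgue_n_def by (intro sets_PiM_I_finite) auto
    then have "emeasure (density (lebesgue_n n) (\<lambda>x. \<Prod>i<n. ennreal (gen_gaussian_density p (x i)))) (Pi\<^sub>E {..<n} A)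
      = (\<integral>\<^sup>+x. (\<Prod>i<n. ennreal (gen_gaussian_density p (x i))) * indicator (Pi\<^sub>E {..<n} A) x \<partial>lebesgue_n n)"
      by (subst emeasure_density) auto
    also have "\<dots> = (\<integral>\<^sup>+x. (\<Prod>i<n. ennreal (gen_gaussian_density p (x i)) * indicator (A i) (x i)) \<partial>lebesgue_n n)"
    proof (rule nn_integral_cong)
      fix x :: "nat \<Rightarrow> real" assume "x \<in> space (lebesgue_n n)"
      then have "indicator (Pi\<^sub>E {..<n} A) x = (\<Prod>i<n. indicator (A i) (x i) :: ennreal)"
        by (auto simp: indicator_def space_lebesgue_n PiE_def Pi_def)
      then show "(\<Prod>i<n. ennreal (gen_gaussian_density p (x i))) * indicator (Pi\<^sub>E {..<n} A) x
        = (\<Prod>i<n. ennreal (gen_gaussian_density p (x i)) * indicator (A i) (x i))"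
        by (simp add: prod.distrib)
    qed
    also have "\<dots> = (\<Prod>i<n. \<integral>\<^sup>+x. ennreal (gen_gaussian_density p x) * indicator (A i) x \<partial>lborel)"
      unfolding lebesgue_n_def using A by (intro L.product_nn_integral_prod) auto
    also have "\<dots> = (\<Prod>i<n. emeasure (gen_gaussian p) (A i))"
      using A by (intro prod.cong) (auto simp: gen_gaussian_def emeasure_density)
    finally show "emeasure (density (lebesgue_n n) (\<lambda>x. \<Prod>i<n. ennreal (gen_gaussian_density p (x i)))) (Pi\<^sub>E {..<n} A)
      = (\<Prod>i<n. emeasure (gen_gaussian p) (A i))" .
  next
    show "sets (density (lebesgue_n n) (\<lambda>x. \<Prod>i<n. ennreal (gen_gaussian_density p (x i)))) = sets (Pi\<^sub>M {..<n} (\<lambda>_. gen_gaussian p))"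
      by (simp add: sets_lebesgue_n cong: sets_PiM_cong)
  qed auto
qed

lemma lp_norm_nonneg [simp]: "0 \<le> lp_norm p n x"
  by (simp add: lp_norm_def)

lemma lp_norm_le_iff:
  assumes "0 < p" "0 \<le> r"
  shows "lp_norm p n x \<le> r \<longleftrightarrow> (\<Sum>i<n. \<bar>x i\<bar> powr p) \<le> r powr p"
proof -
  have "lp_norm p n x \<le> r \<longleftrightarrow> lp_norm p n x powr p \<le> r powr p"
    using assms by (simp add: powr_le_cancel_base)
  also have "lp_norm p n x powr p = (\<Sum>i<n. \<bar>x i\<bar> powr p)"
    using assms by (simp add: lp_norm_def powr_powr sum_nonneg)
  finally show ?thesis .
qed

lemma lp_norm_scale:
  assumes "0 < p" "0 \<le> c"
  shows "lp_norm p n (scale_vec n c x) = c * lp_norm p n x"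
proof -
  have "(\<Sum>i<n. \<bar>scale_vec n c x i\<bar> powr p) = c powr p * (\<Sum>i<n. \<bar>x i\<bar> powr p)"
    using assms by (simp add: scale_vec_def abs_mult powr_mult sum_distrib_left)
  then show ?thesis
    using assms by (simp add: lp_norm_def powr_mult powr_powr sum_nonneg)
qed

lemma measurable_lp_norm [measurable]: "lp_norm p n \<in> borel_measurable (lebesgue_n n)"
  unfolding lp_norm_def[abs_def] lebesgue_n_def by measurable

lemma sets_cone: "{x \<in> space (lebesgue_n n). lp_norm q n x \<le> c * lp_norm p n x} \<in> sets (lebesgue_n n)"
proof -
  have "(\<lambda>x. c * lp_norm p n x) \<in> borel_measurable (lebesgue_n n)"
    by (rule borel_measurable_times[OF borel_measurable_const measurable_lp_norm])
  then show ?thesis by (rule borel_measurable_le[OF measurable_lp_norm])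
qed

lemma sets_lp_ball [measurable]: "lp_ball p n \<in> sets (lebesgue_n n)"
  unfolding lp_ball_def by measurable

text \<open>
  The joint density is a function of the p-norm, and the part of a cone inside the p-ball
  of radius \<open>R\<close> is the \<open>R\<close>-fold dilate of its part inside the unit ball. So the weight of
  its sublevel sets is a pure power, and the constant does not depend on the cone.
\<close>
lemma emeasure_PiM_gen_gaussian_cone:
  assumes p: "0 < p" and E [measurable]: "E \<in> sets (lebesgue_n n)"
    and cone: "\<And>c x. 0 < c \<Longrightarrow> x \<in> space (lebesgue_n n) \<Longrightarrow> scale_vec n c x \<in> E \<longleftrightarrow> x \<in> E"
  shows "emeasure (\<Pi>\<^sub>M i\<in>{..<n}. gen_gaussian p) E
    = ennreal (Gamma (1 + n / p) / (2 * Gamma (1 + 1 / p)) ^ n) * emeasure (lebesgue_n n) (E \<inter> lp_ball p n)"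
proof -
  interpret L: sigma_finite_measure "lebesgue_n n" by (rule sigma_finite_lebesgue_n)
  define C where "C = 1 / (2 * p powr (1 / p) * Gamma (1 + 1 / p))"
  have G: "0 < Gamma (1 + 1 / p)" "0 < Gamma (1 + n / p)"
    using p by (simp_all add: Gamma_1_plus_pos)
  have C: "0 < C" using p G by (simp add: C_def)
  let ?\<phi> = "\<lambda>x. (\<Sum>i<n. \<bar>x i\<bar> powr p) / p"
  have [measurable]: "?\<phi> \<in> borel_measurable (lebesgue_n n)"
    unfolding lebesgue_n_def by measurable
  have dens: "(\<Prod>i<n. ennreal (gen_gaussian_density p (x i))) = ennreal (C ^ n) * ennreal (exp (- ?\<phi> x))" for x
  proof -
    have "(\<Prod>i<n. gen_gaussian_density p (x i)) = C ^ n * exp (- ?\<phi> x)"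
      by (simp add: gen_gaussian_density_def C_def prod.distrib prod_dividef power_one_over
          exp_sum[symmetric] sum_divide_distrib sum_negf)
    then show ?thesis
      using C gen_gaussian_density_pos[OF p] by (subst prod_ennreal) (auto simp: ennreal_mult less_imp_le)
  qed
  have "emeasure (\<Pi>\<^sub>M i\<in>{..<n}. gen_gaussian p) E
    = (\<integral>\<^sup>+x. ennreal (C ^ n) * (indicator E x * ennreal (exp (- ?\<phi> x))) \<partial>lebesgue_n n)"
    unfolding PiM_gen_gaussian_eq_density[OF p]
    by (subst emeasure_density) (auto simp: dens mult_ac)
  also have "\<dots> = ennreal (C ^ n) * (\<integral>\<^sup>+x. indicator E x * ennreal (exp (- ?\<phi> x)) \<partial>lebesgue_n n)"
    by (rule nn_integral_cmult) measurable
  also have "(\<integral>\<^sup>+x. indicator E x * ennreal (exp (- ?\<phi> x)) \<partial>lebesgue_n n)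
    = ennreal (p powr (n / p)) * emeasure (lebesgue_n n) (E \<inter> lp_ball p n) * ennreal (Gamma (1 + n / p))"
  proof (rule L.nn_integral_exp_homogeneous)
    fix u :: real assume u: "0 < u"
    define R where "R = (p * u) powr (1 / p)"
    have R: "0 < R" using p u by (simp add: R_def)
    have Rp: "R powr p = p * u" using p u by (simp add: R_def powr_powr)
    have Rn: "R ^ n = p powr (n / p) * u powr (n / p)"
      using p u by (simp add: R_def powr_powr powr_mult flip: powr_realpow)
    have le: "?\<phi> x \<le> u \<longleftrightarrow> lp_norm p n x \<le> R" for x
      using p R Rp by (simp add: lp_norm_le_iff divide_le_eq mult.commute)
    have "(\<integral>\<^sup>+x. indicator E x * indicator {x. ?\<phi> x \<le> u} x \<partial>lebesgue_n n)
      = (\<integral>\<^sup>+x. indicator {x \<in> space (lebesgue_n n). x \<in> E \<and> lp_norm p n x \<le> R} x \<partial>lebesgue_n n)"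
      by (intro nn_integral_cong) (auto simp: le split: split_indicator)
    also have "\<dots> = emeasure (lebesgue_n n) {x \<in> space (lebesgue_n n). x \<in> E \<and> lp_norm p n x \<le> R}"
      by (rule nn_integral_indicator) measurable
    also have "\<dots> = ennreal (R ^ n) * emeasure (lebesgue_n n)
        {x \<in> space (lebesgue_n n). scale_vec n R x \<in> {x \<in> space (lebesgue_n n). x \<in> E \<and> lp_norm p n x \<le> R}}"
      by (rule emeasure_lebesgue_n_scale[OF R]) measurable
    also have "{x \<in> space (lebesgue_n n). scale_vec n R x \<in> {x \<in> space (lebesgue_n n). x \<in> E \<and> lp_norm p n x \<le> R}}
      = E \<inter> lp_ball p n"
      using sets.sets_into_space[OF E] R p
      by (auto simp: cone lp_norm_scale lp_ball_def)
    finally show "(\<integral>\<^sup>+x. indicator E x * indicator {x. ?\<phi> x \<le> u} x \<partial>lebesgue_n n)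
      = ennreal (p powr (n / p)) * emeasure (lebesgue_n n) (E \<inter> lp_ball p n) * ennreal (u powr (n / p))"
      by (simp add: Rn ennreal_mult mult_ac)
  qed (use p in \<open>auto intro!: sum_nonneg divide_nonneg_pos\<close>)
  also have "ennreal (C ^ n) * (ennreal (p powr (n / p)) * emeasure (lebesgue_n n) (E \<inter> lp_ball p n) * ennreal (Gamma (1 + n / p)))
    = ennreal (C ^ n * p powr (n / p) * Gamma (1 + n / p)) * emeasure (lebesgue_n n) (E \<inter> lp_ball p n)"
    using C G p by (simp add: ennreal_mult mult_ac)
  also have "C ^ n * p powr (n / p) * Gamma (1 + n / p) = Gamma (1 + n / p) / (2 * Gamma (1 + 1 / p)) ^ n"
  proof -
    have "p powr (n / p) = (p powr (1 / p)) ^ n"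
      using p by (simp add: powr_powr flip: powr_realpow)
    then show ?thesis using p G by (simp add: C_def power_mult_distrib power_divide)
  qed
  finally show ?thesis .
qed

text \<open>The whole space is a cone of probability 1, which determines the volume of the ball.\<close>
lemma
  assumes p: "0 < p"
  shows emeasure_lp_ball: "emeasure (lebesgue_n n) (lp_ball p n)
      = ennreal ((2 * Gamma (1 + 1 / p)) ^ n / Gamma (1 + n / p))"
    and vol_lp_ball: "vol n (lp_ball p n) = (2 * Gamma (1 + 1 / p)) ^ n / Gamma (1 + n / p)"
proof -
  define D where "D = Gamma (1 + n / p) / (2 * Gamma (1 + 1 / p)) ^ n"
  have D: "0 < D" using p by (simp add: D_def Gamma_1_plus_pos)
  interpret P: prob_space "\<Pi>\<^sub>M i\<in>{..<n}. gen_gaussian p"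
    by (intro prob_space_PiM prob_space_gen_gaussian p)
  have sp: "space (\<Pi>\<^sub>M i\<in>{..<n}. gen_gaussian p) = space (lebesgue_n n)"
    by (simp add: lebesgue_n_def space_PiM)
  have "1 = ennreal D * emeasure (lebesgue_n n) (space (lebesgue_n n) \<inter> lp_ball p n)"
    using P.emeasure_space_1 emeasure_PiM_gen_gaussian_cone[OF p sets.top, of n] by (simp add: sp D_def)
  also have "space (lebesgue_n n) \<inter> lp_ball p n = lp_ball p n"
    by (auto simp: lp_ball_def)
  finally have one: "1 = ennreal D * emeasure (lebesgue_n n) (lp_ball p n)" .
  have "emeasure (lebesgue_n n) (lp_ball p n) = ennreal (1 / D) * (ennreal D * emeasure (lebesgue_n n) (lp_ball p n))"
  proof -
    have "ennreal (1 / D) * ennreal D = ennreal (1 / D * D)"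
      using D by (intro ennreal_mult[symmetric]) auto
    then show ?thesis using D by (simp add: mult.assoc[symmetric])
  qed
  also have "\<dots> = ennreal (1 / D)"
    by (simp flip: one)
  finally show *: "emeasure (lebesgue_n n) (lp_ball p n) = ennreal ((2 * Gamma (1 + 1 / p)) ^ n / Gamma (1 + n / p))"
    by (simp add: D_def)
  then show "vol n (lp_ball p n) = (2 * Gamma (1 + 1 / p)) ^ n / Gamma (1 + n / p)"
    using p by (simp add: vol_def measure_def Gamma_1_plus_pos less_imp_le)
qed

lemma vol_lp_ball_pos: "0 < p \<Longrightarrow> 0 < vol n (lp_ball p n)"
  by (simp add: vol_lp_ball Gamma_1_plus_pos)

lemma measure_PiM_gen_gaussian_cone:
  assumes p: "0 < p" and E [measurable]: "E \<in> sets (lebesgue_n n)"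
    and cone: "\<And>c x. 0 < c \<Longrightarrow> x \<in> space (lebesgue_n n) \<Longrightarrow> scale_vec n c x \<in> E \<longleftrightarrow> x \<in> E"
  shows "measure (\<Pi>\<^sub>M i\<in>{..<n}. gen_gaussian p) E = vol n (E \<inter> lp_ball p n) / vol n (lp_ball p n)"
  using p by (simp add: measure_def emeasure_PiM_gen_gaussian_cone[OF assms] enn2real_mult vol_lp_ball
      vol_def[of _ "E \<inter> _"] Gamma_1_plus_pos less_imp_le)

section \<open>The intersection as a section of the ball\<close>

lemma dilate_eq_scale_image: "dilate n c A = scale_vec n c ` A"
  by (simp add: dilate_def scale_vec_def[abs_def])

lemma dilate_dilate: "dilate n a (dilate n b A) = dilate n (a * b) A"
  by (simp add: dilate_eq_scale_image image_image scale_vec_scale_vec)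

text \<open>
  The factor \<open>c = 0\<close> is included because the q-ball may be dilated by 0: both sides are
  then the origin.
\<close>
lemma dilate_lp_ball:
  assumes p: "0 < p" and c: "0 \<le> c"
  shows "dilate n c (lp_ball p n) = {x \<in> space (lebesgue_n n). lp_norm p n x \<le> c}"
proof (intro equalityI subsetI)
  fix x assume "x \<in> dilate n c (lp_ball p n)"
  then show "x \<in> {x \<in> space (lebesgue_n n). lp_norm p n x \<le> c}"
    using p c by (auto simp: dilate_eq_scale_image lp_ball_def lp_norm_scale mult_left_le)
next
  fix x assume x: "x \<in> {x \<in> space (lebesgue_n n). lp_norm p n x \<le> c}"
  show "x \<in> dilate n c (lp_ball p n)"
  proof (cases "c = 0")
    case False
    with c have "0 < c" by simp
    then have "x = scale_vec n c (scale_vec n (1 / c) x)" "scale_vec n (1 / c) x \<in> lp_ball p n"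
      using x p by (auto simp: scale_vec_scale_vec scale_vec_1 lp_ball_def lp_norm_scale)
    then show ?thesis unfolding dilate_eq_scale_image by blast
  next
    case True
    have "(\<Sum>i<n. \<bar>x i\<bar> powr p) \<le> 0"
      using x p True lp_norm_le_iff[of p 0 n x] by simp
    then have "(\<Sum>i<n. \<bar>x i\<bar> powr p) = 0"
      by (intro antisym sum_nonneg) auto
    then have "x i = 0" if "i < n" for i
      using that by (subst (asm) sum_nonneg_eq_0_iff) auto
    then have "x = scale_vec n 0 (scale_vec n 0 x)"
      using x by (auto simp: scale_vec_def space_lebesgue_n extensional_def)
    moreover have "scale_vec n 0 x \<in> lp_ball p n"
      using p by (simp add: lp_ball_def lp_norm_scale)
    ultimately show ?thesis unfolding dilate_eq_scale_image True by blast
  qed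
qed

definition ball_fraction :: "real \<Rightarrow> real \<Rightarrow> nat \<Rightarrow> real \<Rightarrow> real" where
  "ball_fraction p q n c = vol n {x \<in> lp_ball p n. lp_norm q n x \<le> c} / vol n (lp_ball p n)"

definition cone_prob :: "real \<Rightarrow> real \<Rightarrow> nat \<Rightarrow> real \<Rightarrow> real" where
  "cone_prob p q n c = measure (\<Pi>\<^sub>M i\<in>{..<n}. gen_gaussian p)
     {x \<in> space (lebesgue_n n). lp_norm q n x \<le> c * lp_norm p n x}"

lemma vol_scale:
  assumes "0 < c" "A \<in> sets (lebesgue_n n)"
  shows "vol n A = c ^ n * vol n {x \<in> space (lebesgue_n n). scale_vec n c x \<in> A}"
  using assms by (simp add: vol_def measure_def emeasure_lebesgue_n_scale[OF assms] enn2real_mult less_imp_le)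

text \<open>
  Scaling by the radius of the normalized p-ball turns the intersection into a section of
  the unit p-ball. The two normalizing radii enter only through their quotient, which
  \<^const>\<open>A_seq\<close> expresses relative to the typical norm ratio.
\<close>
lemma vol_normalized_intersection:
  assumes p: "0 < p" and q: "0 < q" and t: "0 \<le> t" and n: "1 \<le> n"
  shows "vol n (normalized_lp_ball p n \<inter> dilate n t (normalized_lp_ball q n))
    = ball_fraction p q n (t * A_seq p q n * (m_const p q * n powr (1 / q - 1 / p)))"
proof -
  define a where "a = vol n (lp_ball p n) powr (- 1 / n)"
  define b where "b = vol n (lp_ball q n) powr (- 1 / n)"
  have V: "0 < vol n (lp_ball p n)" "0 < vol n (lp_ball q n)"
    using p q by (simp_all add: vol_lp_ball_pos)
  have ab: "0 < a" "0 < b" using V by (simp_all add: a_def b_def)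
  have an: "a ^ n = 1 / vol n (lp_ball p n)"
  proof -
    have "a ^ n = a powr n" using ab by (simp add: powr_realpow)
    also have "\<dots> = vol n (lp_ball p n) powr (- 1)" using n by (simp add: a_def powr_powr)
    also have "\<dots> = 1 / vol n (lp_ball p n)" using V by (simp add: powr_minus_divide)
    finally show ?thesis .
  qed
  have m: "0 < m_const p q" using p q abs_moment_pos[of p q] by (simp add: m_const_def)
  have k: "k_const p n = n powr (1 / p) / a" "k_const q n = n powr (1 / q) / b"
    using V by (simp_all add: k_const_def a_def b_def powr_minus_divide)
  have ratio: "A_seq p q n * (m_const p q * n powr (1 / q - 1 / p)) = b / a"
    using n m ab by (simp add: A_seq_def k powr_diff)
  have [measurable]: "{x \<in> space (lebesgue_n n). lp_norm p n x \<le> a \<and> lp_norm q n x \<le> t * b} \<in> sets (lebesgue_n n)"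
    by measurable
  have "normalized_lp_ball p n \<inter> dilate n t (normalized_lp_ball q n)
    = {x \<in> space (lebesgue_n n). lp_norm p n x \<le> a \<and> lp_norm q n x \<le> t * b}"
  proof -
    have "normalized_lp_ball p n = {x \<in> space (lebesgue_n n). lp_norm p n x \<le> a}"
      using dilate_lp_ball[OF p, of a n] ab by (simp add: normalized_lp_ball_def a_def)
    moreover have "dilate n t (normalized_lp_ball q n) = dilate n (t * b) (lp_ball q n)"
      by (simp add: normalized_lp_ball_def b_def dilate_dilate)
    moreover have "\<dots> = {x \<in> space (lebesgue_n n). lp_norm q n x \<le> t * b}"
      using t ab by (intro dilate_lp_ball[OF q]) auto
    ultimately show ?thesis by (simp only:) blast
  qed
  then have "vol n (normalized_lp_ball p n \<inter> dilate n t (normalized_lp_ball q n))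
    = a ^ n * vol n {x \<in> space (lebesgue_n n).
        scale_vec n a x \<in> {x \<in> space (lebesgue_n n). lp_norm p n x \<le> a \<and> lp_norm q n x \<le> t * b}}"
    by (simp only:) (rule vol_scale[OF ab(1)], measurable)
  also have "{x \<in> space (lebesgue_n n). scale_vec n a x \<in>
      {x \<in> space (lebesgue_n n). lp_norm p n x \<le> a \<and> lp_norm q n x \<le> t * b}}
    = {x \<in> lp_ball p n. lp_norm q n x \<le> t * (b / a)}"
    using ab p q by (auto simp: lp_norm_scale lp_ball_def field_simps)
  finally show ?thesis
    by (simp add: an ball_fraction_def mult.assoc ratio)
qed

lemma fmeasurable_lp_ball: "0 < p \<Longrightarrow> lp_ball p n \<in> fmeasurable (lebesgue_n n)"
  by (rule fmeasurableI) (simp_all add: emeasure_lp_ball sets_lp_ball)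

lemma vol_mono_lp_ball:
  assumes "0 < p" "A \<in> sets (lebesgue_n n)" "B \<in> sets (lebesgue_n n)" "A \<subseteq> B" "B \<subseteq> lp_ball p n"
  shows "vol n A \<le> vol n B"
  unfolding vol_def using assms fmeasurableI2[OF fmeasurable_lp_ball[OF assms(1)] assms(5,3)]
  by (intro measure_mono_fmeasurable) auto

lemma sets_lp_ball_section [measurable]: "{x \<in> lp_ball p n. lp_norm q n x \<le> c} \<in> sets (lebesgue_n n)"
proof -
  have "{x \<in> lp_ball p n. lp_norm q n x \<le> c} = {x \<in> space (lebesgue_n n). lp_norm p n x \<le> 1 \<and> lp_norm q n x \<le> c}"
    by (auto simp: lp_ball_def)
  then show ?thesis by simp
qed

lemma ball_fraction_mono:
  assumes "0 < p" "c \<le> c'"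
  shows "ball_fraction p q n c \<le> ball_fraction p q n c'"
  unfolding ball_fraction_def using assms vol_lp_ball_pos[of p n]
  by (intro divide_right_mono vol_mono_lp_ball[of p]) auto

lemma
  assumes "0 < p"
  shows ball_fraction_nonneg: "0 \<le> ball_fraction p q n c"
    and ball_fraction_le_1: "ball_fraction p q n c \<le> 1"
proof -
  have "vol n {x \<in> lp_ball p n. lp_norm q n x \<le> c} \<le> vol n (lp_ball p n)"
    using assms by (intro vol_mono_lp_ball[of p]) (auto simp: sets_lp_ball)
  then show "0 \<le> ball_fraction p q n c" "ball_fraction p q n c \<le> 1"
    using vol_lp_ball_pos[OF assms, of n] by (auto simp: ball_fraction_def vol_def)
qed

lemma cone_prob_eq_vol:
  assumes p: "0 < p" and q: "0 < q"
  shows "cone_prob p q n c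
    = vol n {x \<in> lp_ball p n. lp_norm q n x \<le> c * lp_norm p n x} / vol n (lp_ball p n)"
proof -
  have "{x \<in> space (lebesgue_n n). lp_norm q n x \<le> c * lp_norm p n x} \<inter> lp_ball p n
    = {x \<in> lp_ball p n. lp_norm q n x \<le> c * lp_norm p n x}"
    by (auto simp: lp_ball_def)
  moreover have "scale_vec n k x \<in> {x \<in> space (lebesgue_n n). lp_norm q n x \<le> c * lp_norm p n x}
      \<longleftrightarrow> x \<in> {x \<in> space (lebesgue_n n). lp_norm q n x \<le> c * lp_norm p n x}"
    if k: "0 < k" and x: "x \<in> space (lebesgue_n n)" for k x
  proof -
    have "k * lp_norm q n x \<le> c * (k * lp_norm p n x) \<longleftrightarrow> k * lp_norm q n x \<le> k * (c * lp_norm p n x)"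
      by (simp only: mult.left_commute)
    also have "\<dots> \<longleftrightarrow> lp_norm q n x \<le> c * lp_norm p n x"
      using k by simp
    finally show ?thesis
      using k x p q by (simp add: lp_norm_scale)
  qed
  ultimately show ?thesis
    unfolding cone_prob_def by (subst measure_PiM_gen_gaussian_cone[OF p sets_cone]) (assumption | simp only:)+
qed

lemma sets_cone_section [measurable]:
  "{x \<in> lp_ball p n. lp_norm q n x \<le> c * lp_norm p n x} \<in> sets (lebesgue_n n)"
proof -
  have "{x \<in> lp_ball p n. lp_norm q n x \<le> c * lp_norm p n x}
    = lp_ball p n \<inter> {x \<in> space (lebesgue_n n). lp_norm q n x \<le> c * lp_norm p n x}"
    by (auto simp: lp_ball_def)
  then show ?thesis using sets.Int[OF sets_lp_ball sets_cone] by simp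
qed

text \<open>
  On the unit p-ball the cone condition is the stronger one, because the p-norm is at most
  1.
\<close>
lemma cone_prob_le_ball_fraction:
  assumes p: "0 < p" and q: "0 < q" and c: "0 \<le> c"
  shows "cone_prob p q n c \<le> ball_fraction p q n c"
proof -
  have "{x \<in> lp_ball p n. lp_norm q n x \<le> c * lp_norm p n x} \<subseteq> {x \<in> lp_ball p n. lp_norm q n x \<le> c}"
    using c by (auto simp: lp_ball_def intro: order_trans[OF _ mult_left_le])
  then show ?thesis
    unfolding cone_prob_eq_vol[OF p q] ball_fraction_def using p vol_lp_ball_pos[of p n]
    by (intro divide_right_mono vol_mono_lp_ball[of p]) auto
qed

text \<open>
  Points of p-norm at least \<open>\<rho>\<close> satisfy the cone condition with the threshold \<open>c / \<rho>\<close>, and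
  the others fill only the fraction \<open>\<rho> ^ n\<close> of the ball. In high dimension this costs
  almost nothing.
\<close>
lemma ball_fraction_le_cone_prob:
  assumes p: "0 < p" and q: "0 < q" and c: "0 \<le> c" and \<rho>: "0 < \<rho>" "\<rho> \<le> 1"
  shows "ball_fraction p q n c \<le> \<rho> ^ n + cone_prob p q n (c / \<rho>)"
proof -
  let ?V = "vol n (lp_ball p n)"
  let ?S = "{x \<in> space (lebesgue_n n). lp_norm p n x \<le> \<rho>}"
  let ?E = "{x \<in> lp_ball p n. lp_norm q n x \<le> c / \<rho> * lp_norm p n x}"
  have small: "vol n ?S = \<rho> ^ n * ?V"
    using p \<rho> by (subst vol_scale[OF \<rho>(1)]) (auto simp: lp_norm_scale lp_ball_def)
  have S: "?S \<subseteq> lp_ball p n" using \<rho> by (auto simp: lp_ball_def)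
  have "{x \<in> lp_ball p n. lp_norm q n x \<le> c} \<subseteq> ?S \<union> ?E"
  proof
    fix x assume x: "x \<in> {x \<in> lp_ball p n. lp_norm q n x \<le> c}"
    show "x \<in> ?S \<union> ?E"
    proof (cases "lp_norm p n x \<le> \<rho>")
      case False
      then have "c * 1 \<le> c * (lp_norm p n x / \<rho>)"
        using c \<rho> by (intro mult_left_mono) auto
      with x show ?thesis by auto
    qed (use x in \<open>auto simp: lp_ball_def\<close>)
  qed
  then have "vol n {x \<in> lp_ball p n. lp_norm q n x \<le> c} \<le> vol n (?S \<union> ?E)"
    using p S by (intro vol_mono_lp_ball[of p] sets.Un sets_lp_ball_section sets_cone_section) auto
  also have "\<dots> \<le> vol n ?S + vol n ?E"
    unfolding vol_def by (rule measure_Un_le) measurable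
  finally show ?thesis
    unfolding ball_fraction_def cone_prob_eq_vol[OF p q] using vol_lp_ball_pos[OF p, of n]
    by (simp add: small field_simps)
qed

section \<open>Approximation in probability\<close>

lemma (in prob_space) expectation_square_sum_indep:
  fixes X :: "nat \<Rightarrow> 'a \<Rightarrow> real"
  assumes indep: "indep_vars (\<lambda>_. borel) X UNIV"
    and mean: "\<And>i. expectation (X i) = 0"
    and sq: "\<And>i. integrable M (\<lambda>\<omega>. (X i \<omega>)\<^sup>2)"
    and var: "\<And>i. expectation (\<lambda>\<omega>. (X i \<omega>)\<^sup>2) = v"
  shows "integrable M (\<lambda>\<omega>. (\<Sum>i<n. X i \<omega>)\<^sup>2)"
    and "expectation (\<lambda>\<omega>. (\<Sum>i<n. X i \<omega>)\<^sup>2) = n * v"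
proof -
  have [measurable]: "random_variable borel (X i)" for i
    using indep by (simp add: indep_vars_def2)
  have int: "integrable M (X i)" for i
    by (rule square_integrable_imp_integrable[OF _ sq]) simp
  have eq: "(\<Sum>i<n. X i \<omega>)\<^sup>2 = (\<Sum>i<n. \<Sum>j<n. X i \<omega> * X j \<omega>)" for \<omega>
    by (simp add: power2_eq_square sum_product)
  have ind: "indep_vars (\<lambda>_. borel) X {i, j}" for i j
    by (rule indep_vars_subset[OF indep]) simp
  have prod: "integrable M (\<lambda>\<omega>. X i \<omega> * X j \<omega>)" for i j
  proof (cases "i = j")
    case False
    then show ?thesis
      using indep_vars_integrable[OF _ ind[of i j] int] by simp
  qed (use sq[of i] in \<open>simp add: power2_eq_square\<close>)
  have E: "expectation (\<lambda>\<omega>. X i \<omega> * X j \<omega>) = (if i = j then v else 0)" for i j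
  proof (cases "i = j")
    case False
    then show ?thesis
      using indep_vars_lebesgue_integral[OF _ ind[of i j] int] by (simp add: mean)
  qed (use var[of i] in \<open>simp add: power2_eq_square\<close>)
  show "integrable M (\<lambda>\<omega>. (\<Sum>i<n. X i \<omega>)\<^sup>2)"
    unfolding eq by (simp add: prod)
  show "expectation (\<lambda>\<omega>. (\<Sum>i<n. X i \<omega>)\<^sup>2) = n * v"
    unfolding eq by (simp add: prod E)
qed

text \<open>
  The mean of \<open>n\<close> terms has variance \<open>v / n\<close>, so its square is small even after
  multiplication by \<open>sqrt n\<close>, by Markov's inequality. This controls the quadratic errors
  of a linearization at the scale of the central limit theorem.
\<close>
lemma (in prob_space) prob_mean_square_tendsto_0:
  fixes X :: "nat \<Rightarrow> 'a \<Rightarrow> real"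
  assumes indep: "indep_vars (\<lambda>_. borel) X UNIV"
    and mean: "\<And>i. expectation (X i) = 0"
    and sq: "\<And>i. integrable M (\<lambda>\<omega>. (X i \<omega>)\<^sup>2)"
    and var: "\<And>i. expectation (\<lambda>\<omega>. (X i \<omega>)\<^sup>2) = v"
    and \<delta>: "0 < \<delta>"
  shows "(\<lambda>n. prob {\<omega> \<in> space M. \<delta> \<le> sqrt n * ((\<Sum>i<n. X i \<omega>) / n)\<^sup>2}) \<longlonglongrightarrow> 0"
proof (rule tendsto_sandwich[where f = "\<lambda>_. 0" and h = "\<lambda>n. v / \<delta> * (1 / sqrt (real n))"])
  note S = expectation_square_sum_indep[OF indep mean sq var]
  have "prob {\<omega> \<in> space M. \<delta> \<le> sqrt n * ((\<Sum>i<n. X i \<omega>) / n)\<^sup>2} \<le> v / \<delta> * (1 / sqrt n)" if "0 < n" for n :: nat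
  proof -
    have eq: "sqrt n * ((\<Sum>i<n. X i \<omega>) / n)\<^sup>2 = sqrt n / (real n)\<^sup>2 * (\<Sum>i<n. X i \<omega>)\<^sup>2" for \<omega>
      by (simp add: power_divide)
    have "prob {\<omega> \<in> space M. \<delta> \<le> sqrt n * ((\<Sum>i<n. X i \<omega>) / n)\<^sup>2}
      \<le> expectation (\<lambda>\<omega>. sqrt n * ((\<Sum>i<n. X i \<omega>) / n)\<^sup>2) / \<delta>"
      unfolding eq using S(1)[of n] \<delta>
      by (intro integral_Markov_inequality_measure[OF _ sets.empty_sets]) auto
    also have "\<dots> = sqrt n / (real n)\<^sup>2 * (n * v) / \<delta>"
      unfolding eq using S by simp
    also have "\<dots> = v / \<delta> * (1 / sqrt n)"
    proof -
      have "real n = sqrt n * sqrt n" by simp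
      then have "sqrt n / (real n)\<^sup>2 * (n * v) / \<delta> = sqrt n / (sqrt n * sqrt n)\<^sup>2 * ((sqrt n * sqrt n) * v) / \<delta>"
        by simp
      also have "\<dots> = v / \<delta> * (1 / sqrt n)"
        using that by (simp add: power2_eq_square del: real_sqrt_mult_self)
      finally show ?thesis .
    qed
    finally show ?thesis .
  qed
  then show "\<forall>\<^sub>F n in sequentially. prob {\<omega> \<in> space M. \<delta> \<le> sqrt n * ((\<Sum>i<n. X i \<omega>) / n)\<^sup>2} \<le> v / \<delta> * (1 / sqrt n)"
    by (rule eventually_mono[OF eventually_gt_at_top[of "0::nat"]])
  have "(\<lambda>n. 1 / sqrt (real n)) \<longlonglongrightarrow> 0"
    by (intro tendsto_divide_0[OF tendsto_const] filterlim_at_top_imp_at_infinity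
        filterlim_compose[OF sqrt_at_top filterlim_real_sequentially])
  then show "(\<lambda>n. v / \<delta> * (1 / sqrt (real n))) \<longlonglongrightarrow> 0"
    by (rule tendsto_mult_right_zero)
qed auto

text \<open>
  A version of Slutsky's theorem for events. The event \<open>E n\<close> need not be of the form
  \<open>{Y n \<le> y}\<close>; it suffices that it lies between two such events for \<open>X n\<close> outside of a set
  of vanishing probability, which avoids taking logarithms of norms that may be zero.
\<close>
lemma (in prob_space) prob_tendsto_of_approximation:
  fixes X :: "nat \<Rightarrow> 'a \<Rightarrow> real" and F :: "real \<Rightarrow> real"
  assumes [measurable]: "\<And>n. random_variable borel (X n)" "\<And>n. E n \<in> events"
    and conv: "\<And>x. (\<lambda>n. prob {\<omega> \<in> space M. X n \<omega> \<le> x}) \<longlonglongrightarrow> F x"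
    and cont: "isCont F y"
    and bad: "\<And>\<epsilon>. 0 < \<epsilon> \<Longrightarrow> \<exists>B. (\<forall>n. B n \<in> events) \<and> (\<lambda>n. prob (B n)) \<longlonglongrightarrow> 0 \<and>
      (\<forall>\<^sub>F n in sequentially. \<forall>\<omega>\<in>space M - B n.
         (\<omega> \<in> E n \<longrightarrow> X n \<omega> \<le> y + \<epsilon>) \<and> (X n \<omega> \<le> y - \<epsilon> \<longrightarrow> \<omega> \<in> E n))"
  shows "(\<lambda>n. prob (E n)) \<longlonglongrightarrow> F y"
proof (rule order_tendstoI)
  fix a assume "F y < a"
  have "((\<lambda>\<epsilon>. F (y + \<epsilon>)) \<longlongrightarrow> F y) (at_right 0)"
    by (rule isCont_tendsto_compose[OF cont]) (auto intro!: tendsto_eq_intros)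
  then have "\<forall>\<^sub>F \<epsilon> in at_right 0. F (y + \<epsilon>) < a"
    using \<open>F y < a\<close> by (auto dest: order_tendstoD)
  with eventually_at_right_less[of "0::real"] have "\<forall>\<^sub>F \<epsilon> in at_right 0. 0 < \<epsilon> \<and> F (y + \<epsilon>) < a"
    by eventually_elim auto
  then obtain \<epsilon> where \<epsilon>: "0 < \<epsilon>" "F (y + \<epsilon>) < a"
    by (auto dest: eventually_happens)
  from bad[OF \<epsilon>(1)] obtain B where [measurable]: "\<And>n. B n \<in> events" and B0: "(\<lambda>n. prob (B n)) \<longlonglongrightarrow> 0"
    and B: "\<forall>\<^sub>F n in sequentially. \<forall>\<omega>\<in>space M - B n.
         (\<omega> \<in> E n \<longrightarrow> X n \<omega> \<le> y + \<epsilon>) \<and> (X n \<omega> \<le> y - \<epsilon> \<longrightarrow> \<omega> \<in> E n)" by blast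
  have "(\<lambda>n. prob {\<omega> \<in> space M. X n \<omega> \<le> y + \<epsilon>} + prob (B n)) \<longlonglongrightarrow> F (y + \<epsilon>) + 0"
    by (intro tendsto_add conv B0)
  then have "\<forall>\<^sub>F n in sequentially. prob {\<omega> \<in> space M. X n \<omega> \<le> y + \<epsilon>} + prob (B n) < a"
    using \<epsilon> by (auto dest: order_tendstoD)
  with B show "\<forall>\<^sub>F n in sequentially. prob (E n) < a"
  proof eventually_elim
    case (elim n)
    have "prob (E n) \<le> prob ({\<omega> \<in> space M. X n \<omega> \<le> y + \<epsilon>} \<union> B n)"
      using elim(1) sets.sets_into_space[OF assms(2)[of n]] by (intro finite_measure_mono) auto
    also have "\<dots> \<le> prob {\<omega> \<in> space M. X n \<omega> \<le> y + \<epsilon>} + prob (B n)"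
      by (intro measure_Un_le) measurable
    finally show ?case using elim(2) by simp
  qed
next
  fix a assume "a < F y"
  have "((\<lambda>\<epsilon>. F (y - \<epsilon>)) \<longlongrightarrow> F y) (at_right 0)"
    by (rule isCont_tendsto_compose[OF cont]) (auto intro!: tendsto_eq_intros)
  then have "\<forall>\<^sub>F \<epsilon> in at_right 0. a < F (y - \<epsilon>)"
    using \<open>a < F y\<close> by (auto dest: order_tendstoD)
  with eventually_at_right_less[of "0::real"] have "\<forall>\<^sub>F \<epsilon> in at_right 0. 0 < \<epsilon> \<and> a < F (y - \<epsilon>)"
    by eventually_elim auto
  then obtain \<epsilon> where \<epsilon>: "0 < \<epsilon>" "a < F (y - \<epsilon>)"
    by (auto dest: eventually_happens)
  from bad[OF \<epsilon>(1)] obtain B where [measurable]: "\<And>n. B n \<in> events" and B0: "(\<lambda>n. prob (B n)) \<longlonglongrightarrow> 0"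
    and B: "\<forall>\<^sub>F n in sequentially. \<forall>\<omega>\<in>space M - B n.
         (\<omega> \<in> E n \<longrightarrow> X n \<omega> \<le> y + \<epsilon>) \<and> (X n \<omega> \<le> y - \<epsilon> \<longrightarrow> \<omega> \<in> E n)" by blast
  have "(\<lambda>n. prob {\<omega> \<in> space M. X n \<omega> \<le> y - \<epsilon>} - prob (B n)) \<longlonglongrightarrow> F (y - \<epsilon>) - 0"
    by (intro tendsto_diff conv B0)
  then have "\<forall>\<^sub>F n in sequentially. a < prob {\<omega> \<in> space M. X n \<omega> \<le> y - \<epsilon>} - prob (B n)"
    using \<epsilon> by (auto dest: order_tendstoD)
  with B show "\<forall>\<^sub>F n in sequentially. a < prob (E n)"
  proof eventually_elim
    case (elim n)
    have "prob {\<omega> \<in> space M. X n \<omega> \<le> y - \<epsilon>} \<le> prob (E n \<union> B n)"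
      using elim(1) by (intro finite_measure_mono) auto
    also have "\<dots> \<le> prob (E n) + prob (B n)"
      by (intro measure_Un_le) measurable
    finally show ?case using elim(2) by simp
  qed
qed

section \<open>The centred normal distribution\<close>

lemma cdf_normal_scale:
  assumes s: "0 < s"
  shows "cdf (density lborel (\<lambda>x. ennreal (normal_density 0 s x))) y = cdf std_normal_distribution (y / s)"
proof -
  let ?N = "density lborel (\<lambda>x. ennreal (normal_density 0 s x))"
  interpret N: prob_space ?N by (rule prob_space_normal_density[OF s])
  have "distributed ?N lborel (\<lambda>x. x) (\<lambda>x. ennreal (normal_density 0 s x))"
    by (auto simp: distributed_def distr_id2)
  then have "distributed ?N lborel (\<lambda>x. (x - 0) / s) (\<lambda>x. ennreal (std_normal_density x))"
    by (subst (asm) N.normal_standard_normal_convert[OF s])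
  then have "std_normal_distribution = distr ?N lborel (\<lambda>x. x / s)"
    by (simp add: distributed_def)
  then have "cdf std_normal_distribution (y / s) = measure ?N ((\<lambda>x. x / s) -` {..y / s} \<inter> space ?N)"
    by (simp add: cdf_def measure_distr)
  also have "(\<lambda>x. x / s) -` {..y / s} \<inter> space ?N = {..y}"
    using s by (auto simp: divide_le_cancel)
  finally show ?thesis by (simp add: cdf_def)
qed

lemma isCont_cdf_normal:
  assumes s: "0 < s"
  shows "isCont (cdf (density lborel (\<lambda>x. ennreal (normal_density 0 s x)))) y"
proof -
  let ?N = "density lborel (\<lambda>x. ennreal (normal_density 0 s x))"
  interpret N: prob_space ?N by (rule prob_space_normal_density[OF s])
  interpret R: real_distribution ?N
    by unfold_locales simp
  have "emeasure ?N {y} = 0"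
    by (subst emeasure_density) (auto simp: nn_integral_indicator_singleton)
  then show ?thesis unfolding R.isCont_cdf by (simp add: measure_def)
qed

lemma real_distribution_normal:
  "0 < s \<Longrightarrow> real_distribution (density lborel (\<lambda>x. ennreal (normal_density 0 s x)))"
  using prob_space_normal_density[of s 0] by (simp add: real_distribution_def real_distribution_axioms_def)

lemma cdf_normal_0:
  assumes s: "0 < s"
  shows "cdf (density lborel (\<lambda>x. ennreal (normal_density 0 s x))) 0 = 1 / 2"
proof -
  let ?N = "density lborel (\<lambda>x. ennreal (normal_density 0 s x))"
  interpret N: real_distribution ?N by (rule real_distribution_normal[OF s])
  have "distributed ?N lborel (\<lambda>x. x) (\<lambda>x. ennreal (normal_density 0 s x))"
    by (auto simp: distributed_def distr_id2)
  from N.normal_density_affine[OF this s, of "-1" 0]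
  have "?N = distr ?N lborel uminus"
    by (simp add: distributed_def)
  then have "measure ?N {..0} = measure (distr ?N lborel uminus) {..0}" by simp
  also have "\<dots> = measure ?N {0..}"
    by (subst measure_distr) (auto intro!: arg_cong[where f = "measure ?N"])
  finally have sym: "measure ?N {..0} = measure ?N {0..}" .
  have "measure ?N {0} = 0"
    using isCont_cdf_normal[OF s, of 0] N.isCont_cdf by blast
  moreover have "measure ?N {0..} = measure ?N {0} + measure ?N {0<..}"
  proof -
    have "{0::real..} = {0} \<union> {0<..}" by auto
    then show ?thesis using N.finite_measure_Union[of "{0}" "{0<..}"] by simp
  qed
  moreover have "1 = measure ?N {..0} + measure ?N {0<..}"
  proof -
    have "measure ?N (space ?N) = measure ?N ({..0} \<union> {0<..})"
      by (rule arg_cong[where f = "measure ?N"]) auto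
    moreover have "measure ?N (space ?N) = 1" by (rule N.prob_space)
    moreover have "{..0} \<inter> {0<..} = ({} :: real set)" by auto
    ultimately show ?thesis using N.finite_measure_Union[of "{..0}" "{0<..}"] by simp
  qed
  ultimately show ?thesis using sym by (simp add: cdf_def)
qed

section \<open>The central limit theorem for the norm ratio\<close>

text \<open>
  An infinite sequence of coordinates, so that the sums for all \<open>n\<close> live on one space, as
  the central limit theorem requires.
\<close>
definition sample_space :: "real \<Rightarrow> (nat \<Rightarrow> real) measure" where
  "sample_space p = (\<Pi>\<^sub>M i\<in>UNIV. gen_gaussian p)"

lemma prob_space_sample_space: "0 < p \<Longrightarrow> prob_space (sample_space p)"
  unfolding sample_space_def by (intro prob_space_PiM prob_space_gen_gaussian)

lemma space_sample_space [simp]: "space (sample_space p) = UNIV"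
  by (simp add: sample_space_def space_PiM)

lemma measurable_coordinate [measurable]: "(\<lambda>\<omega>. \<omega> i) \<in> borel_measurable (sample_space p)"
proof -
  have "(\<lambda>\<omega>. \<omega> i) \<in> sample_space p \<rightarrow>\<^sub>M gen_gaussian p"
    unfolding sample_space_def by simp
  then show ?thesis by (simp cong: measurable_cong_sets)
qed

lemma distr_coordinate:
  assumes p: "0 < p"
  shows "distr (sample_space p) borel (\<lambda>\<omega>. \<omega> i) = gen_gaussian p"
proof -
  have "distr (sample_space p) (gen_gaussian p) (\<lambda>\<omega>. \<omega> i) = gen_gaussian p"
    unfolding sample_space_def using p by (intro distr_PiM_component prob_space_gen_gaussian) auto
  then show ?thesis by (simp cong: distr_cong)
qed

lemma indep_vars_coordinates:
  fixes f :: "real \<Rightarrow> real"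
  assumes p: "0 < p" and [measurable]: "f \<in> borel_measurable borel"
  shows "prob_space.indep_vars (sample_space p) (\<lambda>_. borel) (\<lambda>i \<omega>. f (\<omega> i)) UNIV"
proof -
  interpret prob_space "sample_space p" by (rule prob_space_sample_space[OF p])
  have "distr (sample_space p) (\<Pi>\<^sub>M i\<in>UNIV. borel) (\<lambda>x. x) = distr (sample_space p) (sample_space p) (\<lambda>x. x)"
    by (intro distr_cong) (auto simp: sample_space_def intro!: sets_PiM_cong)
  then have "indep_vars (\<lambda>_. borel) (\<lambda>i \<omega>. \<omega> i) UNIV"
    by (subst indep_vars_iff_distr_eq_PiM')
       (auto simp: distr_coordinate[OF p] restrict_UNIV sample_space_def[symmetric])
  then show ?thesis
    by (rule indep_vars_compose2) simp
qed

lemma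
  fixes f :: "real \<Rightarrow> real"
  assumes p: "0 < p" and [measurable]: "f \<in> borel_measurable borel"
  shows integrable_coordinate: "integrable (sample_space p) (\<lambda>\<omega>. f (\<omega> i)) \<longleftrightarrow> integrable (gen_gaussian p) f"
    and integral_coordinate: "(\<integral>\<omega>. f (\<omega> i) \<partial>sample_space p) = (\<integral>x. f x \<partial>gen_gaussian p)"
  using integrable_distr_eq[of "\<lambda>\<omega>. \<omega> i" "sample_space p" borel f]
    integral_distr[of "\<lambda>\<omega>. \<omega> i" "sample_space p" borel f]
  by (simp_all add: distr_coordinate[OF p])

lemma borel_measurable_coordinate_sum:
  fixes f :: "real \<Rightarrow> real"
  assumes "f \<in> borel_measurable borel"
  shows "(\<lambda>\<omega>. \<Sum>i<n. f (\<omega> i)) \<in> borel_measurable (sample_space p)"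
proof (rule borel_measurable_sum)
  fix i
  show "(\<lambda>\<omega>. f (\<omega> i)) \<in> borel_measurable (sample_space p)"
    by (rule measurable_compose[OF measurable_coordinate assms])
qed

text \<open>
  This is the central limit theorem for identically distributed terms, rescaled from unit
  variance to the variance \<^term>\<open>sigma_sq p q\<close>.
\<close>
lemma score_sum_tendsto_normal:
  assumes p: "0 < p" and q: "0 < q" and "p \<noteq> q"
  shows "(\<lambda>n. measure (sample_space p) {\<omega> \<in> space (sample_space p). (\<Sum>i<n. log_ratio_score p q (\<omega> i)) / sqrt n \<le> y})
    \<longlonglongrightarrow> cdf (density lborel (\<lambda>s. ennreal (normal_density 0 (sqrt (sigma_sq p q)) s))) y"
proof -
  interpret prob_space "sample_space p" by (rule prob_space_sample_space[OF p])
  let ?f = "log_ratio_score p q"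
  define s where "s = sqrt (sigma_sq p q)"
  have s: "0 < s" and s2: "s\<^sup>2 = sigma_sq p q"
    using sigma_sq_pos[OF assms] by (simp_all add: s_def)
  have mean: "expectation (\<lambda>\<omega>. ?f (\<omega> i)) = 0" for i
    by (simp add: integral_coordinate[OF p] integral_log_ratio_score[OF p q])
  have "weak_conv_m (\<lambda>n. distr (sample_space p) borel (\<lambda>\<omega>. (\<Sum>i<n. ?f (\<omega> i)) / sqrt (n * s\<^sup>2))) std_normal_distribution"
  proof (rule central_limit_theorem_zero_mean)
    show "indep_vars (\<lambda>_. borel) (\<lambda>i \<omega>. ?f (\<omega> i)) UNIV"
      by (rule indep_vars_coordinates[OF p]) simp
    show "integrable (sample_space p) (\<lambda>\<omega>. (?f (\<omega> n))\<^sup>2)" for n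
      using integrable_log_ratio_score_sq[OF p q] integrable_coordinate[OF p, of "\<lambda>x. (?f x)\<^sup>2"] by simp
    show "variance (\<lambda>\<omega>. ?f (\<omega> n)) = s\<^sup>2" for n
      using integral_coordinate[OF p, of "\<lambda>x. (?f x)\<^sup>2"]
      by (simp add: mean integral_log_ratio_score_sq[OF p q] s2)
    show "distr (sample_space p) borel (\<lambda>\<omega>. ?f (\<omega> n)) = distr (gen_gaussian p) borel ?f" for n
      by (subst distr_coordinate[OF p, of n, symmetric], subst distr_distr) (auto simp: comp_def)
  qed (use s mean in auto)
  moreover have "isCont (cdf std_normal_distribution) (y / s)"
    using isCont_cdf_normal[of 1] by simp
  ultimately have "(\<lambda>n. cdf (distr (sample_space p) borel (\<lambda>\<omega>. (\<Sum>i<n. ?f (\<omega> i)) / sqrt (n * s\<^sup>2))) (y / s))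
      \<longlonglongrightarrow> cdf std_normal_distribution (y / s)"
    unfolding weak_conv_m_def weak_conv_def by blast
  also have "cdf std_normal_distribution (y / s)
    = cdf (density lborel (\<lambda>s. ennreal (normal_density 0 (sqrt (sigma_sq p q)) s))) y"
    using cdf_normal_scale[OF s, of y] by (simp add: s_def)
  also have "(\<lambda>n. cdf (distr (sample_space p) borel (\<lambda>\<omega>. (\<Sum>i<n. ?f (\<omega> i)) / sqrt (n * s\<^sup>2))) (y / s))
    = (\<lambda>n. measure (sample_space p) {\<omega> \<in> space (sample_space p). (\<Sum>i<n. ?f (\<omega> i)) / sqrt n \<le> y})"
  proof
    fix n :: nat
    have "(\<lambda>\<omega>. (\<Sum>i<n. ?f (\<omega> i)) / sqrt (n * s\<^sup>2)) -` {..y / s} \<inter> space (sample_space p)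
      = {\<omega> \<in> space (sample_space p). (\<Sum>i<n. ?f (\<omega> i)) / sqrt n \<le> y}"
      using s by (auto simp: real_sqrt_mult divide_le_cancel simp flip: divide_divide_eq_left)
    then show "cdf (distr (sample_space p) borel (\<lambda>\<omega>. (\<Sum>i<n. ?f (\<omega> i)) / sqrt (n * s\<^sup>2))) (y / s)
      = measure (sample_space p) {\<omega> \<in> space (sample_space p). (\<Sum>i<n. ?f (\<omega> i)) / sqrt n \<le> y}"
      by (simp add: cdf_def measure_distr)
  qed
  finally show ?thesis .
qed

lemma cone_prob_sample_space:
  assumes p: "0 < p"
  shows "cone_prob p q n c = measure (sample_space p) {\<omega> \<in> space (sample_space p). lp_norm q n \<omega> \<le> c * lp_norm p n \<omega>}"
proof -
  interpret G: prob_space "gen_gaussian p" by (rule prob_space_gen_gaussian[OF p])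
  interpret product_prob_space "\<lambda>_. gen_gaussian p" UNIV by unfold_locales
  let ?P = "\<Pi>\<^sub>M i\<in>{..<n}. gen_gaussian p"
  let ?E = "{x \<in> space (lebesgue_n n). lp_norm q n x \<le> c * lp_norm p n x}"
  have sets: "sets ?P = sets (lebesgue_n n)"
    by (simp add: sets_lebesgue_n cong: sets_PiM_cong)
  have E: "?E \<in> sets ?P" unfolding sets by (rule sets_cone)
  have r: "(\<lambda>\<omega>. restrict \<omega> {..<n}) \<in> sample_space p \<rightarrow>\<^sub>M ?P"
    unfolding sample_space_def by (rule measurable_restrict_subset) simp
  have "cone_prob p q n c = measure (distr (sample_space p) ?P (\<lambda>\<omega>. restrict \<omega> {..<n})) ?E"
    unfolding cone_prob_def sample_space_def by (subst distr_PiM_restrict_finite) auto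
  also have "\<dots> = measure (sample_space p) ((\<lambda>\<omega>. restrict \<omega> {..<n}) -` ?E \<inter> space (sample_space p))"
    by (rule measure_distr[OF r E])
  also have "(\<lambda>\<omega>. restrict \<omega> {..<n}) -` ?E \<inter> space (sample_space p)
    = {\<omega> \<in> space (sample_space p). lp_norm q n \<omega> \<le> c * lp_norm p n \<omega>}"
    by (auto simp: lp_norm_def space_lebesgue_n)
  finally show ?thesis .
qed

text \<open>
  The powers of \<open>n\<close> and of the mean \<open>M\<close> in the threshold cancel exactly against those in
  the two norms, so only the relative deviations \<open>\<xi>\<close> and \<open>\<eta>\<close> remain after taking
  logarithms.
\<close>
lemma lp_norm_le_iff_log:
  fixes x :: "nat \<Rightarrow> real" and n :: nat and p q M \<xi> \<eta> y :: real
  assumes p: "0 < p" and q: "0 < q" and M: "0 < M" and n: "0 < n"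
  assumes \<xi>: "(\<Sum>i<n. \<bar>x i\<bar> powr q) = n * M * (1 + \<xi>)" and "-1 < \<xi>"
    and \<eta>: "(\<Sum>i<n. \<bar>x i\<bar> powr p) = n * (1 + \<eta>)" and "-1 < \<eta>"
  shows "lp_norm q n x \<le> exp (y / sqrt n) * (M powr (1 / q) * n powr (1 / q - 1 / p)) * lp_norm p n x
    \<longleftrightarrow> sqrt n * (ln (1 + \<xi>) / q - ln (1 + \<eta>) / p) \<le> y"
proof -
  have pos: "0 < n * M * (1 + \<xi>)" "0 < real n * (1 + \<eta>)" using assms by auto
  have ln: "ln (lp_norm q n x) = (ln n + ln M + ln (1 + \<xi>)) / q" "ln (lp_norm p n x) = (ln n + ln (1 + \<eta>)) / p"
    using assms by (simp_all add: lp_norm_def \<xi> \<eta> ln_mult del: distrib_left)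
  have "lp_norm q n x \<le> exp (y / sqrt n) * (M powr (1 / q) * n powr (1 / q - 1 / p)) * lp_norm p n x
    \<longleftrightarrow> ln (lp_norm q n x) \<le> ln (exp (y / sqrt n) * (M powr (1 / q) * n powr (1 / q - 1 / p)) * lp_norm p n x)"
  proof -
    have "0 < lp_norm q n x" "0 < lp_norm p n x" 
      using pos unfolding lp_norm_def \<xi> \<eta> powr_gt_zero by linarith+
    then show ?thesis using M n by (subst ln_le_cancel_iff) auto
  qed
  also have "ln (exp (y / sqrt n) * (M powr (1 / q) * n powr (1 / q - 1 / p)) * lp_norm p n x)
    = y / sqrt n + (ln M / q + (1 / q - 1 / p) * ln n) + (ln n + ln (1 + \<eta>)) / p"
  proof -
    have "0 < lp_norm p n x"
      using pos unfolding lp_norm_def \<eta> powr_gt_zero by linarith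
    then show ?thesis using M n ln by (simp add: ln_mult ln_powr)
  qed
  also have "ln (lp_norm q n x) \<le> \<dots> \<longleftrightarrow> ln (1 + \<xi>) / q - ln (1 + \<eta>) / p \<le> y / sqrt n"
    unfolding ln by (simp add: algebra_simps add_divide_distrib diff_divide_distrib)
  also have "\<dots> \<longleftrightarrow> sqrt n * (ln (1 + \<xi>) / q - ln (1 + \<eta>) / p) \<le> y"
    using n by (simp add: le_divide_eq mult.commute)
  finally show ?thesis .
qed

text \<open>
  Since \<open>sqrt n \<ge> 1\<close>, the single smallness condition also keeps \<open>\<xi>\<close> in the range where
  \<open>ln (1 + \<xi>)\<close> differs from \<open>\<xi>\<close> by at most \<open>2 * \<xi>\<^sup>2\<close>.
\<close>
lemma sqrt_ln_linearisation:
  fixes \<xi> \<delta> :: real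
  assumes n: "0 < n" and d: "\<delta> \<le> 1 / 4" and \<xi>: "sqrt (real n) * \<xi>\<^sup>2 < \<delta>"
  shows "\<bar>\<xi>\<bar> \<le> 1 / 2" and "\<bar>sqrt n * ln (1 + \<xi>) - sqrt n * \<xi>\<bar> \<le> 2 * \<delta>"
proof -
  have "1 * \<xi>\<^sup>2 \<le> sqrt n * \<xi>\<^sup>2" using n by (intro mult_right_mono) auto
  with \<xi> d have "\<xi>\<^sup>2 \<le> (1 / 2)\<^sup>2" by (simp add: power2_eq_square)
  then show half: "\<bar>\<xi>\<bar> \<le> 1 / 2" using abs_le_square_iff[of \<xi> "1 / 2"] by simp
  have "\<bar>sqrt n * ln (1 + \<xi>) - sqrt n * \<xi>\<bar> = sqrt n * \<bar>ln (1 + \<xi>) - \<xi>\<bar>"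
    by (simp add: abs_mult flip: right_diff_distrib)
  also have "\<dots> \<le> sqrt n * (2 * \<xi>\<^sup>2)"
    by (intro mult_left_mono abs_ln_one_plus_x_minus_x_bound half) simp
  finally show "\<bar>sqrt n * ln (1 + \<xi>) - sqrt n * \<xi>\<bar> \<le> 2 * \<delta>" using \<xi> by simp
qed

text \<open>
  Outside of the events that \<open>sqrt n * \<xi>\<^sup>2\<close> or \<open>sqrt n * \<eta>\<^sup>2\<close> is at least \<open>\<delta>\<close>, which have
  vanishing probability, the logarithm of the norm ratio times \<open>sqrt n\<close> differs from the
  normalized sum of scores by at most \<open>\<epsilon>\<close>.
\<close>
lemma cone_prob_tendsto:
  assumes p: "0 < p" and q: "0 < q" and "p \<noteq> q"
  shows "(\<lambda>n. cone_prob p q n (exp (y / sqrt n) * (m_const p q * n powr (1 / q - 1 / p))))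
    \<longlonglongrightarrow> Phi p q (ereal y)"
proof -
  interpret prob_space "sample_space p" by (rule prob_space_sample_space[OF p])
  let ?M = "abs_moment p q"
  have M: "0 < ?M" using p q by (simp add: abs_moment_pos)
  define Q where "Q x = \<bar>x\<bar> powr q / ?M - 1" for x :: real
  define P where "P x = \<bar>x\<bar> powr p - 1" for x :: real
  have [measurable]: "Q \<in> borel_measurable borel" "P \<in> borel_measurable borel"
    unfolding Q_def[abs_def] P_def[abs_def] by measurable
  let ?E = "\<lambda>n::nat. {\<omega> \<in> space (sample_space p). lp_norm q n \<omega> \<le> exp (y / sqrt n) * (m_const p q * n powr (1 / q - 1 / p)) * lp_norm p n \<omega>}"
  let ?X = "\<lambda>n \<omega>. (\<Sum>i<n. log_ratio_score p q (\<omega> i)) / sqrt (real n)"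
  let ?\<xi> = "\<lambda>n \<omega>. (\<Sum>i<n. Q (\<omega> i)) / real n" and ?\<eta> = "\<lambda>n \<omega>. (\<Sum>i<n. P (\<omega> i)) / real n"
  have score: "log_ratio_score p q x = Q x / q - P x / p" for x
    using M q by (simp add: log_ratio_score_def Q_def P_def abs_moment_self[OF p] diff_divide_distrib)
  have P_eq: "P x = \<bar>x\<bar> powr p - abs_moment p p" and Q_eq: "Q x = (\<bar>x\<bar> powr q - ?M) / ?M" for x
    using M by (simp_all add: P_def Q_def abs_moment_self[OF p] diff_divide_distrib)
  interpret G: prob_space "gen_gaussian p" by (rule prob_space_gen_gaussian[OF p])
  have meanQ: "G.expectation Q = 0" and meanP: "G.expectation P = 0"
    unfolding Q_eq P_eq using integrable_gen_gaussian_powr[OF p] p q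
    by (simp_all add: G.prob_space[simplified] flip: abs_moment_def)
  have "(Q x)\<^sup>2 = (\<bar>x\<bar> powr q - ?M) * (\<bar>x\<bar> powr q - ?M) / ?M\<^sup>2" for x
    by (simp add: Q_eq power2_eq_square)
  then have sqQ: "integrable (gen_gaussian p) (\<lambda>x. (Q x)\<^sup>2)"
    using integrable_centred_product[OF p, of q q] q by simp
  have sqP: "integrable (gen_gaussian p) (\<lambda>x. (P x)\<^sup>2)"
    using integrable_centred_product[OF p, of p p] p by (simp add: P_eq power2_eq_square)
  have small: "(\<lambda>n. prob {\<omega> \<in> space (sample_space p). \<delta> \<le> sqrt n * ((\<Sum>i<n. f (\<omega> i)) / real n)\<^sup>2}) \<longlonglongrightarrow> 0"
    if "0 < \<delta>" "G.expectation f = 0" "integrable (gen_gaussian p) (\<lambda>x. (f x)\<^sup>2)"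
      and [measurable]: "f \<in> borel_measurable borel" for f :: "real \<Rightarrow> real" and \<delta>
    using that integral_coordinate[OF p, of f] integral_coordinate[OF p, of "\<lambda>x. (f x)\<^sup>2"]
      integrable_coordinate[OF p, of "\<lambda>x. (f x)\<^sup>2"]
    by (intro prob_mean_square_tendsto_0[where v = "G.expectation (\<lambda>x. (f x)\<^sup>2)"] indep_vars_coordinates p) simp_all
  have "(\<lambda>n. prob (?E n)) \<longlonglongrightarrow> cdf (density lborel (\<lambda>s. ennreal (normal_density 0 (sqrt (sigma_sq p q)) s))) y"
  proof (rule prob_tendsto_of_approximation[where E = ?E and X = ?X and F = "cdf (density lborel (\<lambda>s. ennreal (normal_density 0 (sqrt (sigma_sq p q)) s)))"])
    have norm_meas: "(\<lambda>\<omega>. lp_norm r n \<omega>) \<in> borel_measurable (sample_space p)" for r n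
      unfolding lp_norm_def by measurable
    show "?E n \<in> events" for n
      by (rule borel_measurable_le[OF norm_meas borel_measurable_times[OF borel_measurable_const norm_meas]])
    show "random_variable borel (?X n)" for n
      by (rule borel_measurable_divide[OF borel_measurable_coordinate_sum borel_measurable_const]) simp
    show "(\<lambda>n. prob {\<omega> \<in> space (sample_space p). ?X n \<omega> \<le> x})
      \<longlonglongrightarrow> cdf (density lborel (\<lambda>s. ennreal (normal_density 0 (sqrt (sigma_sq p q)) s))) x" for x
      by (rule score_sum_tendsto_normal[OF assms])
    show "isCont (cdf (density lborel (\<lambda>s. ennreal (normal_density 0 (sqrt (sigma_sq p q)) s)))) y"
      using sigma_sq_pos[OF assms] by (intro isCont_cdf_normal) simp
    fix \<epsilon> :: real assume \<epsilon>: "0 < \<epsilon>"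
    \<comment> \<open>Each logarithm contributes an error of at most \<open>2 * \<delta>\<close>, divided by \<open>q\<close> or by \<open>p\<close>.\<close>
    define \<delta> where "\<delta> = min (1 / 4) (\<epsilon> / (2 * (1 / q + 1 / p)))"
    have pq: "0 < 1 / q + 1 / p" using p q by (simp add: add_pos_pos)
    have \<delta>: "0 < \<delta>" "\<delta> \<le> 1 / 4" "2 * \<delta> * (1 / q + 1 / p) \<le> \<epsilon>"
    proof -
      have "0 < \<epsilon> / (2 * (1 / q + 1 / p))" using \<epsilon> pq by (intro divide_pos_pos) auto
      then show "0 < \<delta>" unfolding \<delta>_def by simp
      show "\<delta> \<le> 1 / 4" unfolding \<delta>_def by (rule min.cobounded1)
      have "\<delta> \<le> \<epsilon> / (2 * (1 / q + 1 / p))" unfolding \<delta>_def by (rule min.cobounded2)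
      then show "2 * \<delta> * (1 / q + 1 / p) \<le> \<epsilon>" using pq by (simp add: pos_le_divide_eq mult_ac)
    qed
    define B1 where "B1 n = {\<omega> \<in> space (sample_space p). \<delta> \<le> sqrt n * (?\<xi> n \<omega>)\<^sup>2}" for n :: nat
    define B2 where "B2 n = {\<omega> \<in> space (sample_space p). \<delta> \<le> sqrt n * (?\<eta> n \<omega>)\<^sup>2}" for n :: nat
    have "{\<omega> \<in> space (sample_space p). \<delta> \<le> sqrt n * ((\<Sum>i<n. f (\<omega> i)) / real n)\<^sup>2} \<in> events"
      if "f \<in> borel_measurable borel" for f :: "real \<Rightarrow> real" and n :: nat
      by (rule borel_measurable_le[OF borel_measurable_const borel_measurable_times[OF borel_measurable_const
            borel_measurable_power[OF borel_measurable_divide[OF borel_measurable_coordinate_sum[OF that] borel_measurable_const]]]])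
    then have [measurable]: "B1 n \<in> events" "B2 n \<in> events" for n
      unfolding B1_def B2_def by simp_all
    have "(\<lambda>n. prob (B1 n) + prob (B2 n)) \<longlonglongrightarrow> 0 + 0"
      unfolding B1_def B2_def
      by (intro tendsto_add small[OF \<delta>(1) meanQ sqQ] small[OF \<delta>(1) meanP sqP]) simp_all
    then have B_sum: "(\<lambda>n. prob (B1 n) + prob (B2 n)) \<longlonglongrightarrow> 0"
      by simp
    have B0: "(\<lambda>n. prob (B1 n \<union> B2 n)) \<longlonglongrightarrow> 0"
    proof (rule tendsto_sandwich[OF _ _ tendsto_const B_sum])
      show "\<forall>\<^sub>F n in sequentially. prob (B1 n \<union> B2 n) \<le> prob (B1 n) + prob (B2 n)"
        by (intro always_eventually allI measure_Un_le) measurable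
    qed simp
    have good: "(\<omega> \<in> ?E n \<longrightarrow> ?X n \<omega> \<le> y + \<epsilon>) \<and> (?X n \<omega> \<le> y - \<epsilon> \<longrightarrow> \<omega> \<in> ?E n)"
      if n: "0 < n" and \<omega>: "\<omega> \<in> space (sample_space p) - (B1 n \<union> B2 n)" for n :: nat and \<omega>
    proof -
      define \<xi> \<eta> where "\<xi> = ?\<xi> n \<omega>" and "\<eta> = ?\<eta> n \<omega>"
      have lt: "sqrt n * \<xi>\<^sup>2 < \<delta>" "sqrt n * \<eta>\<^sup>2 < \<delta>"
        using \<omega> by (auto simp: B1_def B2_def \<xi>_def \<eta>_def not_le)
      note L = sqrt_ln_linearisation[OF n \<delta>(2) lt(1)] sqrt_ln_linearisation[OF n \<delta>(2) lt(2)]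
      have sums: "(\<Sum>i<n. \<bar>\<omega> i\<bar> powr q) = n * ?M * (1 + \<xi>)" "(\<Sum>i<n. \<bar>\<omega> i\<bar> powr p) = n * (1 + \<eta>)"
      proof -
        have "(\<Sum>i<n. Q (\<omega> i)) = (\<Sum>i<n. \<bar>\<omega> i\<bar> powr q) / ?M - n" "(\<Sum>i<n. P (\<omega> i)) = (\<Sum>i<n. \<bar>\<omega> i\<bar> powr p) - n"
          by (simp_all add: Q_def P_def sum_subtractf sum_divide_distrib)
        then show "(\<Sum>i<n. \<bar>\<omega> i\<bar> powr q) = n * ?M * (1 + \<xi>)" "(\<Sum>i<n. \<bar>\<omega> i\<bar> powr p) = n * (1 + \<eta>)"
          using n M by (simp_all add: \<xi>_def \<eta>_def field_simps)
      qed
      have iff: "\<omega> \<in> ?E n \<longleftrightarrow> sqrt n * (ln (1 + \<xi>) / q - ln (1 + \<eta>) / p) \<le> y"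
        using lp_norm_le_iff_log[OF p q M n sums(1) _ sums(2), of y] L by (simp add: m_const_def)
      have X: "?X n \<omega> = (sqrt n * \<xi>) / q - (sqrt n * \<eta>) / p"
      proof -
        have root: "sqrt n * (S / real n) = S / sqrt n" for S
        proof -
          have "sqrt n * (S / (sqrt n * sqrt n)) = S / sqrt n"
            using n by (simp del: real_sqrt_mult_self)
          then show ?thesis by simp
        qed
        have "(\<Sum>i<n. log_ratio_score p q (\<omega> i)) = (\<Sum>i<n. Q (\<omega> i)) / q - (\<Sum>i<n. P (\<omega> i)) / p"
          by (simp add: score sum_subtractf sum_divide_distrib)
        then show ?thesis
          unfolding \<xi>_def \<eta>_def root by (simp add: diff_divide_distrib mult.commute)
      qed
      have "\<bar>sqrt n * (ln (1 + \<xi>) / q - ln (1 + \<eta>) / p) - ?X n \<omega>\<bar>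
        = \<bar>(sqrt n * ln (1 + \<xi>) - sqrt n * \<xi>) / q - (sqrt n * ln (1 + \<eta>) - sqrt n * \<eta>) / p\<bar>"
        unfolding X by (simp add: right_diff_distrib diff_divide_distrib)
      also have "\<dots> \<le> \<bar>sqrt n * ln (1 + \<xi>) - sqrt n * \<xi>\<bar> / q + \<bar>sqrt n * ln (1 + \<eta>) - sqrt n * \<eta>\<bar> / p"
        using abs_triangle_ineq4[of "(sqrt n * ln (1 + \<xi>) - sqrt n * \<xi>) / q" "(sqrt n * ln (1 + \<eta>) - sqrt n * \<eta>) / p"]
          p q by simp
      also have "\<dots> \<le> 2 * \<delta> / q + 2 * \<delta> / p"
        using L p q by (intro add_mono divide_right_mono) auto
      also have "\<dots> \<le> \<epsilon>" using \<delta>(3) by (simp add: distrib_left)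
      finally show ?thesis unfolding iff by linarith
    qed
    show "\<exists>B. (\<forall>n. B n \<in> events) \<and> (\<lambda>n. prob (B n)) \<longlonglongrightarrow> 0 \<and>
      (\<forall>\<^sub>F n in sequentially. \<forall>\<omega>\<in>space (sample_space p) - B n.
         (\<omega> \<in> ?E n \<longrightarrow> ?X n \<omega> \<le> y + \<epsilon>) \<and> (?X n \<omega> \<le> y - \<epsilon> \<longrightarrow> \<omega> \<in> ?E n))"
    proof (intro exI[of _ "\<lambda>n. B1 n \<union> B2 n"] conjI allI)
      show "B1 n \<union> B2 n \<in> events" for n by measurable
      show "\<forall>\<^sub>F n in sequentially. \<forall>\<omega>\<in>space (sample_space p) - (B1 n \<union> B2 n).
         (\<omega> \<in> ?E n \<longrightarrow> ?X n \<omega> \<le> y + \<epsilon>) \<and> (?X n \<omega> \<le> y - \<epsilon> \<longrightarrow> \<omega> \<in> ?E n)"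
        using eventually_gt_at_top[of "0::nat"]
      proof eventually_elim
        case (elim n)
        show ?case by (intro ballI good[OF elim])
      qed
    qed (rule B0)
  qed
  then show ?thesis
    by (simp add: cone_prob_sample_space[OF p] Phi_def)
qed

section \<open>Stirling bounds and the normalizing constants\<close>

text \<open>
  By the mean value theorem \<open>ln z = ln_Gamma (z + 1) - ln_Gamma z\<close> is a value of the
  increasing function \<^const>\<open>Digamma\<close> between \<open>z\<close> and \<open>z + 1\<close>, whence
  \<open>Digamma z \<le> ln z \<le> Digamma (z + 1)\<close>. The derivative of
  \<open>ln_Gamma (1 + z) - (z * ln z - z)\<close> is therefore between 0 and \<open>1 / z\<close>, and its value at
  1 is 1.
\<close>
lemma ln_Gamma_Stirling_bounds:
  fixes x :: real
  assumes x: "1 \<le> x"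
  shows "1 \<le> ln (Gamma (1 + x)) - (x * ln x - x)" and "ln (Gamma (1 + x)) - (x * ln x - x) \<le> 1 + ln x"
proof -
  have Digamma: "Digamma z \<le> ln z" "ln z \<le> Digamma (z + 1)" if z: "0 < z" for z :: real
  proof -
    have "\<exists>w. z < w \<and> w < z + 1 \<and> ln_Gamma (z + 1) - ln_Gamma z = (z + 1 - z) * Digamma w"
      using z by (intro MVT2) (auto intro!: has_field_derivative_ln_Gamma_real)
    then obtain w where w: "z < w" "w < z + 1" "ln_Gamma (z + 1) - ln_Gamma z = Digamma w"
      by auto
    have "z \<notin> \<int>\<^sub>\<le>\<^sub>0" using nonpos_Ints_nonpos[of z] z by linarith
    then have "Gamma (z + 1) = z * Gamma z" by (rule Gamma_plus1)
    moreover have "ln (z * Gamma z) = ln z + ln (Gamma z)"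
      by (rule ln_mult_pos[OF z Gamma_real_pos[OF z]])
    ultimately have "ln_Gamma (z + 1) - ln_Gamma z = ln z"
      using z by (simp add: ln_Gamma_real_pos)
    with w z show "Digamma z \<le> ln z" "ln z \<le> Digamma (z + 1)"
      using Digamma_real_mono[of z w] Digamma_real_mono[of w "z + 1"] by auto
  qed
  have G: "ln (Gamma (1 + z)) = ln_Gamma (1 + z)" if "0 < z" for z :: real
    using that by (simp add: ln_Gamma_real_pos)
  define f where "f z = ln_Gamma (1 + z) - (z * ln z - z)" for z :: real
  have f1: "f 1 = 1"
    using Gamma_fact[of 1, where 'a = real] by (simp add: f_def ln_Gamma_real_pos)
  have f': "(f has_real_derivative (Digamma (1 + z) - ln z)) (at z)" if "0 < z" for z
    unfolding f_def[abs_def] using that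
    by (auto intro!: derivative_eq_intros)
  have "f 1 \<le> f x"
  proof (rule DERIV_nonneg_imp_nondecreasing[OF x])
    fix z :: real assume "1 \<le> z" "z \<le> x"
    then show "\<exists>y. (f has_real_derivative y) (at z) \<and> 0 \<le> y"
      using f'[of z] Digamma(2)[of z] by (intro exI[of _ "Digamma (1 + z) - ln z"]) (simp_all add: add.commute)
  qed
  moreover have "f x - ln x \<le> f 1 - ln 1"
  proof (rule DERIV_nonpos_imp_nonincreasing[OF x])
    fix z :: real assume z: "1 \<le> z" "z \<le> x"
    have "((\<lambda>z. f z - ln z) has_real_derivative (Digamma (1 + z) - ln z - 1 / z)) (at z)"
      using z f'[of z] by (auto intro!: derivative_eq_intros simp: inverse_eq_divide)
    moreover have "Digamma (1 + z) - ln z - 1 / z \<le> 0"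
      using Digamma_plus1[of z] Digamma(1)[of z] z by (simp add: add.commute)
    ultimately show "\<exists>y. ((\<lambda>z. f z - ln z) has_real_derivative y) (at z) \<and> y \<le> 0"
      by blast
  qed
  ultimately show "1 \<le> ln (Gamma (1 + x)) - (x * ln x - x)" and "ln (Gamma (1 + x)) - (x * ln x - x) \<le> 1 + ln x"
    using x f1 G[of x] by (auto simp: f_def)
qed

lemma ln_k_const:
  assumes p: "0 < p" and n: "0 < n"
  shows "ln (k_const p n) = ln n / p + ln (2 * Gamma (1 + 1 / p)) - ln (Gamma (1 + n / p)) / n"
proof -
  have G: "0 < Gamma (1 + 1 / p)" "0 < Gamma (1 + n / p)" using p by (simp_all add: Gamma_1_plus_pos)
  have V: "0 < vol n (lp_ball p n)" by (rule vol_lp_ball_pos[OF p])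
  have "ln (vol n (lp_ball p n)) = n * ln (2 * Gamma (1 + 1 / p)) - ln (Gamma (1 + n / p))"
  proof -
    have "ln ((2 * Gamma (1 + 1 / p)) ^ n) = n * ln (2 * Gamma (1 + 1 / p))"
      by (rule ln_realpow)
    then show ?thesis
      unfolding vol_lp_ball[OF p] using G by (subst ln_divide_pos) (auto simp: power_mult_distrib)
  qed
  moreover have "ln (k_const p n) = ln n / p + ln (vol n (lp_ball p n)) / n"
    using n V by (simp add: k_const_def ln_mult)
  ultimately show ?thesis using n by (simp add: diff_divide_distrib)
qed

text \<open>
  The \<open>n\<close>-th root in \<^const>\<open>k_const\<close> divides the logarithmic Stirling error by \<open>n\<close>, leaving
  \<open>O(ln n / n)\<close>.
\<close>
lemma ln_k_const_asymp:
  assumes p: "0 < p"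
  shows "(\<lambda>n. sqrt n * (ln (k_const p n) - (ln (2 * Gamma (1 + 1 / p)) + (1 + ln p) / p))) \<longlonglongrightarrow> 0"
proof (rule Lim_null_comparison)
  have "\<forall>\<^sub>F n::nat in sequentially. max p 1 \<le> real n"
    using eventually_ge_at_top[of "nat \<lceil>max p 1\<rceil>"] by eventually_elim linarith
  then show "\<forall>\<^sub>F n in sequentially. norm (sqrt n * (ln (k_const p n) - (ln (2 * Gamma (1 + 1 / p)) + (1 + ln p) / p)))
    \<le> sqrt n * ((1 + ln (n / p)) / n)"
  proof eventually_elim
    case (elim n)
    then have n: "0 < n" and x: "1 \<le> n / p" using p by auto
    define f where "f = ln (Gamma (1 + n / p)) - (n / p * ln (n / p) - n / p)"
    have f: "0 \<le> f" "f \<le> 1 + ln (n / p)"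
      using ln_Gamma_Stirling_bounds[OF x] by (simp_all add: f_def)
    have "ln (Gamma (1 + n / p)) / n = f / n + (ln n - ln p - 1) / p"
      using n p by (simp add: f_def ln_div field_simps)
    then have "ln (k_const p n) - (ln (2 * Gamma (1 + 1 / p)) + (1 + ln p) / p) = - (f / n)"
      using ln_k_const[OF p n] by (simp add: diff_divide_distrib add_divide_distrib)
    then have "norm (sqrt n * (ln (k_const p n) - (ln (2 * Gamma (1 + 1 / p)) + (1 + ln p) / p))) = sqrt n * (f / n)"
      using f by (simp add: abs_mult)
    also have "\<dots> \<le> sqrt n * ((1 + ln (n / p)) / n)"
      using f by (intro mult_left_mono divide_right_mono) auto
    finally show ?case .
  qed
  show "(\<lambda>n. sqrt (real n) * ((1 + ln (real n / p)) / real n)) \<longlonglongrightarrow> 0"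
    using p by real_asymp
qed

lemma
  assumes p: "0 < p" and q: "0 < q"
  shows A_lim_pos: "0 < A_lim p q"
    and ln_A_seq_asymp: "(\<lambda>n. sqrt n * (ln (A_seq p q n) - ln (A_lim p q))) \<longlonglongrightarrow> 0"
    and A_seq_pos: "0 < n \<Longrightarrow> 0 < A_seq p q n"
proof -
  have m: "0 < m_const p q" using abs_moment_pos[of p q] p q by (simp add: m_const_def)
  have k: "0 < k_const r n" if "0 < r" "0 < n" for r n
    using that vol_lp_ball_pos[OF that(1), of n] by (simp add: k_const_def)
  then show A: "0 < A_seq p q n" if "0 < n" for n using that m p q by (simp add: A_seq_def)
  define \<kappa> where "\<kappa> r = ln (2 * Gamma (1 + 1 / r)) + (1 + ln r) / r" for r :: real
  define \<Lambda> where "\<Lambda> = \<kappa> p - \<kappa> q - ln (m_const p q)"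
  have "(\<lambda>n. sqrt n * (ln (k_const p n) - \<kappa> p) - sqrt n * (ln (k_const q n) - \<kappa> q)) \<longlonglongrightarrow> 0 - 0"
    unfolding \<kappa>_def by (intro tendsto_diff ln_k_const_asymp p q)
  moreover have "\<forall>\<^sub>F n in sequentially. sqrt n * (ln (k_const p n) - \<kappa> p) - sqrt n * (ln (k_const q n) - \<kappa> q)
    = sqrt n * (ln (A_seq p q n) - \<Lambda>)"
    using eventually_gt_at_top[of 0]
  proof eventually_elim
    case (elim n)
    show ?case using m k[OF p elim] k[OF q elim]
      by (simp add: A_seq_def \<Lambda>_def ln_div ln_mult algebra_simps)
  qed
  ultimately have lim: "(\<lambda>n. sqrt n * (ln (A_seq p q n) - \<Lambda>)) \<longlonglongrightarrow> 0"
    by (simp add: tendsto_cong)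
  have "(\<lambda>n. 1 / sqrt (real n)) \<longlonglongrightarrow> 0" by real_asymp
  from tendsto_mult[OF this lim]
  have "(\<lambda>n. 1 / sqrt n * (sqrt n * (ln (A_seq p q n) - \<Lambda>))) \<longlonglongrightarrow> 0" by simp
  then have "(\<lambda>n. exp (1 / sqrt n * (sqrt n * (ln (A_seq p q n) - \<Lambda>)) + \<Lambda>)) \<longlonglongrightarrow> exp (0 + \<Lambda>)"
    by (intro tendsto_intros)
  moreover have "\<forall>\<^sub>F n in sequentially. exp (1 / sqrt n * (sqrt n * (ln (A_seq p q n) - \<Lambda>)) + \<Lambda>) = A_seq p q n"
    using eventually_gt_at_top[of 0] by eventually_elim (simp add: A)
  ultimately have "A_seq p q \<longlonglongrightarrow> exp \<Lambda>"
    by (simp add: tendsto_cong)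
  then have "A_lim p q = exp \<Lambda>" unfolding A_lim_def by (rule limI)
  with lim show "0 < A_lim p q" "(\<lambda>n. sqrt n * (ln (A_seq p q n) - ln (A_lim p q))) \<longlonglongrightarrow> 0"
    by simp_all
qed

section \<open>The critical window\<close>

text \<open>
  The radius \<open>\<rho> = exp (- \<epsilon> / sqrt n)\<close> balances the two errors of the upper bound: \<open>\<rho> ^ n\<close>
  tends to 0, while dividing the threshold by \<open>\<rho>\<close> merely replaces \<open>y\<close> by \<open>y + \<epsilon>\<close>, and the
  limit is continuous in \<open>y\<close>.
\<close>
lemma ball_fraction_tendsto:
  assumes p: "0 < p" and q: "0 < q" and "p \<noteq> q"
  shows "(\<lambda>n. ball_fraction p q n (exp (y / sqrt n) * (m_const p q * n powr (1 / q - 1 / p))))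
    \<longlonglongrightarrow> Phi p q (ereal y)"
proof (rule order_tendstoI)
  fix a assume "a < Phi p q (ereal y)"
  then have "\<forall>\<^sub>F n in sequentially. a < cone_prob p q n (exp (y / sqrt n) * (m_const p q * n powr (1 / q - 1 / p)))"
    using order_tendstoD(1)[OF cone_prob_tendsto[OF assms]] by blast
  then show "\<forall>\<^sub>F n in sequentially. a < ball_fraction p q n (exp (y / sqrt n) * (m_const p q * n powr (1 / q - 1 / p)))"
  proof eventually_elim
    case (elim n)
    also have "cone_prob p q n (exp (y / sqrt n) * (m_const p q * n powr (1 / q - 1 / p)))
      \<le> ball_fraction p q n (exp (y / sqrt n) * (m_const p q * n powr (1 / q - 1 / p)))"
      by (rule cone_prob_le_ball_fraction[OF p q]) (simp add: m_const_def)
    finally show ?case .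
  qed
next
  fix a assume a: "Phi p q (ereal y) < a"
  have "isCont (\<lambda>y. Phi p q (ereal y)) y"
    using isCont_cdf_normal[of "sqrt (sigma_sq p q)" y] sigma_sq_pos[OF assms] by (simp add: Phi_def)
  then have "((\<lambda>\<epsilon>. Phi p q (ereal (y + \<epsilon>))) \<longlongrightarrow> Phi p q (ereal y)) (at_right 0)"
    by (rule isCont_tendsto_compose) (auto intro!: tendsto_eq_intros)
  from order_tendstoD(2)[OF this a] eventually_at_right_less[of "0::real"]
  have "\<forall>\<^sub>F \<epsilon> in at_right 0. 0 < \<epsilon> \<and> Phi p q (ereal (y + \<epsilon>)) < a"
    by eventually_elim auto
  then obtain \<epsilon> where \<epsilon>: "0 < \<epsilon>" "Phi p q (ereal (y + \<epsilon>)) < a"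
    using eventually_happens'[OF trivial_limit_at_right_real] by blast
  have "(\<lambda>n. exp (- \<epsilon> / sqrt (real n)) ^ n) \<longlonglongrightarrow> 0"
  proof -
    have "exp (- \<epsilon> / sqrt (real n)) ^ n = exp (- \<epsilon> * sqrt n)" for n
    proof -
      have "exp (- \<epsilon> / sqrt (real n)) ^ n = exp (- \<epsilon> * (real n / sqrt (real n)))"
        by (simp add: exp_of_nat_mult[symmetric] mult.commute)
      then show ?thesis by (simp only: real_div_sqrt of_nat_0_le_iff)
    qed
    moreover have "(\<lambda>n. exp (- \<epsilon> * sqrt (real n))) \<longlonglongrightarrow> 0"
      using \<epsilon>(1) by real_asymp
    ultimately show ?thesis by simp
  qed
  from tendsto_add[OF this cone_prob_tendsto[OF assms, of "y + \<epsilon>"]]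
  have "\<forall>\<^sub>F n in sequentially. exp (- \<epsilon> / sqrt n) ^ n
      + cone_prob p q n (exp ((y + \<epsilon>) / sqrt n) * (m_const p q * n powr (1 / q - 1 / p))) < a"
    using \<epsilon>(2) by (auto dest: order_tendstoD(2))
  then show "\<forall>\<^sub>F n in sequentially. ball_fraction p q n (exp (y / sqrt n) * (m_const p q * n powr (1 / q - 1 / p))) < a"
  proof eventually_elim
    case (elim n)
    let ?c = "m_const p q * n powr (1 / q - 1 / p)"
    have "exp (y / sqrt n) * ?c / exp (- \<epsilon> / sqrt n) = exp (y / sqrt n - - \<epsilon> / sqrt n) * ?c"
      by (simp only: exp_diff) simp
    also have "y / sqrt n - - \<epsilon> / sqrt n = (y + \<epsilon>) / sqrt n" by (simp add: add_divide_distrib)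
    finally have "exp (y / sqrt n) * ?c / exp (- \<epsilon> / sqrt n) = exp ((y + \<epsilon>) / sqrt n) * ?c" .
    then have "ball_fraction p q n (exp (y / sqrt n) * ?c)
      \<le> exp (- \<epsilon> / sqrt n) ^ n + cone_prob p q n (exp ((y + \<epsilon>) / sqrt n) * ?c)"
      using ball_fraction_le_cone_prob[OF p q, of "exp (y / sqrt n) * ?c" "exp (- \<epsilon> / sqrt n)" n] \<epsilon>(1)
      by (simp add: m_const_def)
    with elim show ?case by simp
  qed
qed

text \<open>
  Every number in the unit interval is a value of \<^const>\<open>Phi\<close>: the infinite arguments provide 0
  and 1, the intermediate value theorem the numbers in between.
\<close>
lemma Phi_inv_Phi:
  assumes p: "0 < p" and q: "0 < q" and "p \<noteq> q" and r: "0 \<le> r" "r \<le> 1"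
  shows "Phi p q (inv (Phi p q) r) = r"
proof -
  define s where "s = sqrt (sigma_sq p q)"
  let ?F = "cdf (density lborel (\<lambda>x. ennreal (normal_density 0 s x)))"
  have s: "0 < s" using sigma_sq_pos[OF assms(1-3)] by (simp add: s_def)
  interpret N: real_distribution "density lborel (\<lambda>x. ennreal (normal_density 0 s x))"
    by (rule real_distribution_normal[OF s])
  have Phi: "Phi p q (ereal y) = ?F y" for y by (simp add: Phi_def s_def)
  have "r \<in> range (Phi p q)"
  proof (cases "r = 0 \<or> r = 1")
    case True
    then show ?thesis
    proof
      assume "r = 0"
      then have "Phi p q (- \<infinity>) = r" by (simp add: Phi_def)
      then show ?thesis by blast
    next
      assume "r = 1"
      then have "Phi p q \<infinity> = r" by (simp add: Phi_def)
      then show ?thesis by blast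
    qed
  next
    case False
    with r have r: "0 < r" "r < 1" by auto
    obtain a where a: "?F a < r"
      using order_tendstoD(2)[OF N.cdf_lim_at_bot r(1)] eventually_happens[of _ "at_bot :: real filter"] by auto
    obtain b where b: "r < ?F b"
      using order_tendstoD(1)[OF N.cdf_lim_at_top_prob r(2)] eventually_happens[of _ "at_top :: real filter"] by auto
    have "a \<le> b"
      using a b N.cdf_nondecreasing[of b a] by linarith
    then obtain y where "?F y = r"
      using IVT[of ?F a r b] a b isCont_cdf_normal[OF s] by auto
    then show ?thesis using Phi by (metis rangeI)
  qed
  then show ?thesis by (rule f_inv_into_f)
qed

text \<open>
  Together with the next lemma, this treats finite and infinite arguments alike: along the
  reals, \<^const>\<open>Phi\<close> is continuous from the right, at \<open>-\<infinity>\<close> too, and from the left, at \<open>\<infinity>\<close> too.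
\<close>
lemma ex_Phi_less_above:
  assumes p: "0 < p" and q: "0 < q" and "p \<noteq> q" and a: "Phi p q x < a" and "x \<noteq> \<infinity>"
  shows "\<exists>y. x < ereal y \<and> Phi p q (ereal y) < a"
proof -
  define s where "s = sqrt (sigma_sq p q)"
  let ?F = "cdf (density lborel (\<lambda>x. ennreal (normal_density 0 s x)))"
  have s: "0 < s" using sigma_sq_pos[OF assms(1-3)] by (simp add: s_def)
  interpret N: real_distribution "density lborel (\<lambda>x. ennreal (normal_density 0 s x))"
    by (rule real_distribution_normal[OF s])
  have Phi: "Phi p q (ereal y) = ?F y" for y by (simp add: Phi_def s_def)
  show ?thesis
  proof (cases x)
    case (real u)
    have "(?F \<longlongrightarrow> ?F u) (at_right u)"
      using isCont_cdf_normal[OF s, of u] by (simp add: isCont_def filterlim_at_split)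
    from order_tendstoD(2)[OF this, of a] a eventually_at_right_less[of u]
    have "\<forall>\<^sub>F y in at_right u. u < y \<and> ?F y < a"
      by (auto simp: real Phi elim: eventually_elim2)
    then obtain y where "u < y" "?F y < a"
      using eventually_happens'[OF trivial_limit_at_right_real] by blast
    then show ?thesis by (auto simp: real Phi)
  next
    case MInf
    then have "0 < a" using a by (simp add: Phi_def)
    then obtain y where "?F y < a"
      using order_tendstoD(2)[OF N.cdf_lim_at_bot] eventually_happens[of _ "at_bot :: real filter"] by auto
    then show ?thesis using MInf by (auto simp: Phi)
  qed (use assms in simp)
qed

lemma ex_less_Phi_below:
  assumes p: "0 < p" and q: "0 < q" and "p \<noteq> q" and a: "a < Phi p q x" and "x \<noteq> - \<infinity>"
  shows "\<exists>y. ereal y < x \<and> a < Phi p q (ereal y)"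
proof -
  define s where "s = sqrt (sigma_sq p q)"
  let ?F = "cdf (density lborel (\<lambda>x. ennreal (normal_density 0 s x)))"
  have s: "0 < s" using sigma_sq_pos[OF assms(1-3)] by (simp add: s_def)
  interpret N: real_distribution "density lborel (\<lambda>x. ennreal (normal_density 0 s x))"
    by (rule real_distribution_normal[OF s])
  have Phi: "Phi p q (ereal y) = ?F y" for y by (simp add: Phi_def s_def)
  show ?thesis
  proof (cases x)
    case (real u)
    have "(?F \<longlongrightarrow> ?F u) (at_left u)"
      using isCont_cdf_normal[OF s, of u] by (simp add: isCont_def filterlim_at_split)
    moreover have "\<forall>\<^sub>F y in at_left u. y < u"
      by (simp add: eventually_at_filter)
    ultimately have "\<forall>\<^sub>F y in at_left u. y < u \<and> a < ?F y"
      using a order_tendstoD(1)[of ?F "?F u" "at_left u" a] by (auto simp: real Phi elim: eventually_elim2)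
    then obtain y where "y < u" "a < ?F y"
      using eventually_happens'[OF trivial_limit_at_left_real] by blast
    then show ?thesis by (auto simp: real Phi)
  next
    case PInf
    then have "a < 1" using a by (simp add: Phi_def)
    then obtain y where "a < ?F y"
      using order_tendstoD(1)[OF N.cdf_lim_at_top_prob] eventually_happens[of _ "at_top :: real filter"] by auto
    then show ?thesis using PInf by (auto simp: Phi)
  qed (use assms in simp)
qed

text \<open>
  For real \<open>y > x\<close> the threshold is eventually at most \<open>exp (y / sqrt n)\<close>, and for \<open>y < x\<close>
  at least that, so monotonicity encloses the share between values whose limits are known.
  A slightly different exponent in between absorbs both the replacement of
  \<open>1 + y / sqrt n\<close> by an exponential and the factor \<open>exp (d n / sqrt n)\<close> by which
  \<open>A_seq p q n\<close> differs from its limit.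
\<close>
lemma ball_fraction_critical_window:
  assumes p: "0 < p" and q: "0 < q" and "p \<noteq> q"
    and lim: "(\<lambda>n. ereal (sqrt (real n) * (t n * A_lim p q - 1))) \<longlonglongrightarrow> x"
  shows "(\<lambda>n. ball_fraction p q n (t n * A_seq p q n * (m_const p q * n powr (1 / q - 1 / p)))) \<longlonglongrightarrow> Phi p q x"
proof (rule order_tendstoI)
  let ?c = "\<lambda>n::nat. m_const p q * n powr (1 / q - 1 / p)"
  let ?A = "A_lim p q"
  define d where "d n = sqrt n * (ln (A_seq p q n) - ln ?A)" for n :: nat
  have d: "d \<longlonglongrightarrow> 0" unfolding d_def[abs_def] by (rule ln_A_seq_asymp[OF p q])
  have A: "0 < ?A" by (rule A_lim_pos[OF p q])
  have tA: "t n * A_seq p q n = t n * ?A * exp (d n / sqrt n)" if "0 < n" for n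
  proof -
    have "exp (d n / sqrt n) = A_seq p q n / ?A"
      using that A A_seq_pos[OF p q that] by (simp add: d_def exp_diff)
    then show ?thesis using A by simp
  qed
  have mono: "ball_fraction p q n (u * ?c n) \<le> ball_fraction p q n (v * ?c n)" if "u \<le> v" for u v n
    using that by (intro ball_fraction_mono[OF p] mult_right_mono) (simp_all add: m_const_def)
  {
    fix a assume a: "Phi p q x < a"
    show "\<forall>\<^sub>F n in sequentially. ball_fraction p q n (t n * A_seq p q n * ?c n) < a"
    proof (cases "x = \<infinity>")
      case True
      then have "1 < a" using a by (simp add: Phi_def)
      then show ?thesis
        using ball_fraction_le_1[OF p] by (intro always_eventually allI) (meson le_less_trans)
    next
      case False
      from ex_Phi_less_above[OF assms(1-3) a False]
      obtain y where y: "x < ereal y" "Phi p q (ereal y) < a" by blast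
      from ereal_dense2[OF y(1)] obtain y' where y': "x < ereal y'" "ereal y' < ereal y" by blast
      have "\<forall>\<^sub>F n in sequentially. sqrt (real n) * (t n * ?A - 1) < y'"
        using order_tendstoD(2)[OF lim y'(1)] by simp
      moreover have "\<forall>\<^sub>F n in sequentially. d n < y - y'"
        using order_tendstoD(2)[OF d] y'(2) by simp
      moreover have "\<forall>\<^sub>F n in sequentially. ball_fraction p q n (exp (y / sqrt n) * ?c n) < a"
        by (rule order_tendstoD(2)[OF ball_fraction_tendsto[OF assms(1-3)] y(2)])
      ultimately show ?thesis
        using eventually_gt_at_top[of 0]
      proof eventually_elim
        case (elim n)
        have "t n * ?A \<le> 1 + y' / sqrt n"
          using elim(1,4) by (simp add: field_simps)
        also have "\<dots> \<le> exp (y' / sqrt n)" by (rule exp_ge_add_one_self)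
        finally have "t n * A_seq p q n \<le> exp (y' / sqrt n) * exp (d n / sqrt n)"
          unfolding tA[OF elim(4)] by (rule mult_right_mono) simp
        also have "\<dots> = exp ((y' + d n) / sqrt n)" by (simp add: exp_add[symmetric] add_divide_distrib)
        also have "\<dots> \<le> exp (y / sqrt n)"
          using elim(2) by (simp add: divide_right_mono)
        finally have "ball_fraction p q n (t n * A_seq p q n * ?c n) \<le> ball_fraction p q n (exp (y / sqrt n) * ?c n)"
          by (rule mono)
        with elim(3) show ?case by simp
      qed
    qed
  next
    fix a assume a: "a < Phi p q x"
    show "\<forall>\<^sub>F n in sequentially. a < ball_fraction p q n (t n * A_seq p q n * ?c n)"
    proof (cases "x = - \<infinity>")
      case True
      then have "a < 0" using a by (simp add: Phi_def)
      then show ?thesis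
        using ball_fraction_nonneg[OF p] by (intro always_eventually allI) (meson less_le_trans)
    next
      case False
      from ex_less_Phi_below[OF assms(1-3) a False]
      obtain y where y: "ereal y < x" "a < Phi p q (ereal y)" by blast
      from ereal_dense2[OF y(1)] obtain y' where y': "ereal y < ereal y'" "ereal y' < x" by blast
      from y'(1) obtain y'' where y'': "y < y''" "y'' < y'" using dense[of y y'] by auto
      have "\<forall>\<^sub>F n in sequentially. y' < sqrt (real n) * (t n * ?A - 1)"
        using order_tendstoD(1)[OF lim y'(2)] by simp
      moreover have "\<forall>\<^sub>F n in sequentially. y - y'' < d n"
        using order_tendstoD(1)[OF d] y''(1) by simp
      moreover have "\<forall>\<^sub>F n in sequentially. a < ball_fraction p q n (exp (y / sqrt n) * ?c n)"
        by (rule order_tendstoD(1)[OF ball_fraction_tendsto[OF assms(1-3)] y(2)])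
      moreover have "\<forall>\<^sub>F n in sequentially. sqrt (real n) * (exp (y'' / sqrt n) - 1) < y'"
      proof (rule order_tendstoD(2)[OF _ y''(2)])
        show "(\<lambda>n. sqrt (real n) * (exp (y'' / sqrt n) - 1)) \<longlonglongrightarrow> y''"
          by real_asymp
      qed
      ultimately show ?thesis
        using eventually_gt_at_top[of 0]
      proof eventually_elim
        case (elim n)
        have "sqrt n * (exp (y'' / sqrt n) - 1) \<le> sqrt n * (t n * ?A - 1)"
          using elim(1,4) by simp
        then have le: "exp (y'' / sqrt n) \<le> t n * ?A"
          using elim(5) by simp
        have "exp (y / sqrt n) \<le> exp ((y'' + d n) / sqrt n)"
          using elim(2) by (simp add: divide_right_mono)
        also have "\<dots> = exp (y'' / sqrt n) * exp (d n / sqrt n)" by (simp add: exp_add[symmetric] add_divide_distrib)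
        also have "\<dots> \<le> t n * A_seq p q n"
          unfolding tA[OF elim(5)] using le by (rule mult_right_mono) simp
        finally have "ball_fraction p q n (exp (y / sqrt n) * ?c n) \<le> ball_fraction p q n (t n * A_seq p q n * ?c n)"
          by (rule mono)
        with elim(3) show ?case by simp
      qed
    qed
  }
qed

lemma vol_intersection_tendsto:
  assumes p: "0 < p" and q: "0 < q" and "p \<noteq> q" and t: "\<forall>n\<ge>1. 0 \<le> t n"
    and lim: "(\<lambda>n. ereal (sqrt (real n) * (t n * A_lim p q - 1))) \<longlonglongrightarrow> x"
  shows "(\<lambda>n. vol n (normalized_lp_ball p n \<inter> dilate n (t n) (normalized_lp_ball q n))) \<longlonglongrightarrow> Phi p q x"
proof (rule Lim_transform_eventually[OF ball_fraction_critical_window[OF p q assms(3) lim]])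
  show "\<forall>\<^sub>F n in sequentially. ball_fraction p q n (t n * A_seq p q n * (m_const p q * n powr (1 / q - 1 / p)))
    = vol n (normalized_lp_ball p n \<inter> dilate n (t n) (normalized_lp_ball q n))"
    using eventually_ge_at_top[of 1] by eventually_elim (use t vol_normalized_intersection[OF p q] in auto)
qed

theorem corollary4p3:
  fixes p q :: real
  assumes "0 < p" and "0 < q" and "p \<noteq> q"
  shows "(\<forall>(r::real) (t::nat \<Rightarrow> real).
            0 \<le> r \<and> r \<le> 1 \<and> (\<forall>n\<ge>1. 0 \<le> t n) \<and>
            (\<lambda>n. ereal (sqrt (real n) * (t n * A_lim p q - 1))) \<longlonglongrightarrow> inv (Phi p q) r
            \<longrightarrow> (\<lambda>n. vol n (normalized_lp_ball p n \<inter> dilate n (t n) (normalized_lp_ball q n)))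
                  \<longlonglongrightarrow> r)
       \<and> (\<forall>t::real. 0 \<le> t \<longrightarrow>
            (\<lambda>n. vol n (normalized_lp_ball p n \<inter> dilate n t (normalized_lp_ball q n)))
              \<longlonglongrightarrow> (if t < 1 / A_lim p q then 0
                  else if t = 1 / A_lim p q then 1 / 2
                  else 1))"
proof (intro conjI allI impI)
  fix r :: real and t :: "nat \<Rightarrow> real"
  assume *: "0 \<le> r \<and> r \<le> 1 \<and> (\<forall>n\<ge>1. 0 \<le> t n) \<and>
            (\<lambda>n. ereal (sqrt (real n) * (t n * A_lim p q - 1))) \<longlonglongrightarrow> inv (Phi p q) r"
  then show "(\<lambda>n. vol n (normalized_lp_ball p n \<inter> dilate n (t n) (normalized_lp_ball q n))) \<longlonglongrightarrow> r"
    using vol_intersection_tendsto[OF assms, of t "inv (Phi p q) r"] Phi_inv_Phi[OF assms, of r] by simp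
next
  fix t :: real assume t: "0 \<le> t"
  have A: "0 < A_lim p q" by (rule A_lim_pos[OF assms(1,2)])
  define c where "c = t * A_lim p q - 1"
  have V: "(\<lambda>n. vol n (normalized_lp_ball p n \<inter> dilate n t (normalized_lp_ball q n))) \<longlonglongrightarrow> Phi p q x"
    if "(\<lambda>n. ereal (sqrt (real n) * c)) \<longlonglongrightarrow> x" for x
    using vol_intersection_tendsto[OF assms, of "\<lambda>_. t" x] that t by (simp add: c_def)
  consider "c < 0" "t < 1 / A_lim p q" | "c = 0" "t = 1 / A_lim p q" | "c > 0" "t > 1 / A_lim p q"
    using A by (cases t "1 / A_lim p q" rule: linorder_cases) (auto simp: c_def field_simps)
  then show "(\<lambda>n. vol n (normalized_lp_ball p n \<inter> dilate n t (normalized_lp_ball q n)))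
              \<longlonglongrightarrow> (if t < 1 / A_lim p q then 0 else if t = 1 / A_lim p q then 1 / 2 else 1)"
  proof cases
    case 1
    have "filterlim (\<lambda>n. sqrt (real n) * c) at_bot sequentially"
      using 1(1) by real_asymp
    then have "(\<lambda>n. ereal (sqrt (real n) * c)) \<longlonglongrightarrow> - \<infinity>"
      by (simp add: tendsto_MInfty filterlim_at_bot_dense)
    from V[OF this] 1 show ?thesis by (simp add: Phi_def)
  next
    case 2
    have "(\<lambda>n. ereal (sqrt (real n) * c)) \<longlonglongrightarrow> ereal 0"
      using 2 by simp
    from V[OF this] 2 show ?thesis
      using cdf_normal_0[of "sqrt (sigma_sq p q)"] sigma_sq_pos[OF assms] by (simp add: Phi_def)
  next
    case 3
    have "filterlim (\<lambda>n. sqrt (real n) * c) at_top sequentially"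
      using 3(1) by real_asymp
    then have "(\<lambda>n. ereal (sqrt (real n) * c)) \<longlonglongrightarrow> \<infinity>"
      by (simp add: tendsto_PInfty_eq_at_top)
    from V[OF this] 3 show ?thesis by (simp add: Phi_def)
  qed
qed

end
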